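(* Suppose that $f \in \mathbb{C}[x]$ is conservative, and $f$ has at least two (distinct) critical points. Let $n\ge 1$, let $p\in\mathbb{C}$ be a point that is not a critical value of $f^{\circ n}$, let $R_n=\{x\in\mathbb{C}: f^{\circ n}(x)=p\}$, and let $G = MG_n(f)$ act naturally on the tree $T_n$ of preimages of $p$. Let $E \subset R_n$ contain points in at least two major branches of $R_n$. Then the smallest $G$-block of $R_n$ containing $E$ is all of $R_n$.
   Context: A polynomial $f\in\mathbb{C}[x]$ is conservative if every critical point of $f$ in $\mathbb{C}$ is a fixed point of $f$. $f^{\circ n}$ denotes the $n$th iterate of $f$ and $\mathcal V_n$ the set of critical values of $f^{\circ n}$. For $p\in\mathbb{C}\setminus \mathcal V_n$, lifting closed loops at $p$ in $\mathbb{C}\setminus \mathcal V_n$ through $f^{\circ n}$ gives an action of $\pi_1(\mathbb{C}\setminus \mathcal V_n,p)$ on $R_n$; the resulting group of permutations of $R_n$ is the monodromy group $MG_n(f)=MG(f^{\circ n})$. The tree of preimages $T_n$ has vertex levels $R_m=\{x: f^{\circ m}(x)=p\}$, $0\le m\le n$, with each $x\in R_m$ ($m\geq 1$) joined to $f(x)\in R_{m-1}$; the action of $MG_n(f)$ on $R_n$ extends to an action on $T_n$ by tree automorphisms. The major branches of $R_n$ are the sets $\{y\in R_n: f^{\circ (n-1)}(y)=x\}$, where $x$ ranges over $R_1=f^{-1}(p)$. If a group $G$ acts on a finite set $S$, a subset $E\subseteq S$ is a $G$-block if for every $g\in G$ the set $g(E)\cap E$ is equal to either $E$ or $\emptyset$.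 *)

theory Defs
  imports
    "HOL-Analysis.Analysis"
    "HOL-Computational_Algebra.Polynomial"
    "HOL-Combinatorics.Permutations"
begin

definition critical_points :: "complex poly \<Rightarrow> complex set" where
  "critical_points f = {c. poly (pderiv f) c = 0}"

definition critical_values :: "complex poly \<Rightarrow> complex set" where
  "critical_values f = poly f ` critical_points f"

definition conservative :: "complex poly \<Rightarrow> bool" where
  "conservative f \<longleftrightarrow> (\<forall>c\<in>critical_points f. poly f c = c)"

definition poly_iterate :: "'a::comm_semiring_1 poly \<Rightarrow> nat \<Rightarrow> 'a poly" where
  "poly_iterate f n = (pcompose f ^^ n) [:0, 1:]"

lemma poly_poly_iterate: "poly (poly_iterate f n) = poly f ^^ n"
  by (induction n) (auto simp: poly_iterate_def poly_pcompose fun_eq_iff)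

definition is_lift :: "complex poly \<Rightarrow> (real \<Rightarrow> complex) \<Rightarrow> (real \<Rightarrow> complex) \<Rightarrow> bool" where
  "is_lift F \<gamma> h \<longleftrightarrow> path h \<and> (\<forall>t\<in>{0..1}. poly F (h t) = \<gamma> t)"

definition loops_at :: "complex set \<Rightarrow> complex \<Rightarrow> (real \<Rightarrow> complex) set" where
  "loops_at U p = {\<gamma>. path \<gamma> \<and> path_image \<gamma> \<subseteq> U \<and> pathstart \<gamma> = p \<and> pathfinish \<gamma> = p}"

text \<open>
  The monodromy group \<open>MG(F)\<close> based at \<open>p\<close>, as a set of permutations of the fibre of \<open>F\<close> over
  \<open>p\<close>: a loop \<open>\<gamma>\<close> sends \<open>x\<close> to the end point of the lift of \<open>\<gamma>\<close> starting at \<open>x\<close>.  For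
  nonconstant \<open>F\<close> and \<open>p\<close> not a critical value, lifts exist, are unique, and have end points
  depending only on the homotopy class of \<open>\<gamma>\<close>, so every loop induces exactly one permutation.
  Permutations are extended by the identity outside the fibre, as in \<^const>\<open>permutes\<close>.
\<close>

definition monodromy_group :: "complex poly \<Rightarrow> complex \<Rightarrow> (complex \<Rightarrow> complex) set" where
  "monodromy_group F p =
     {\<sigma>. \<sigma> permutes {x. poly F x = p} \<and>
         (\<exists>\<gamma>\<in>loops_at (- critical_values F) p. \<forall>x. poly F x = p \<longrightarrow>
            (\<exists>h. is_lift F \<gamma> h \<and> pathstart h = x \<and> pathfinish h = \<sigma> x))}"

lemma monodromy_group_id:
  assumes "p \<notin> critical_values F"
  shows "id \<in> monodromy_group F p"
proof -
  have "linepath p p \<in> loops_at (- critical_values F) p"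
    using assms by (simp add: loops_at_def)
  moreover have "\<exists>h. is_lift F (linepath p p) h \<and> pathstart h = x \<and> pathfinish h = id x"
    if "poly F x = p" for x
  proof -
    have "is_lift F (linepath p p) (linepath x x)"
      using that unfolding is_lift_def
      by (intro conjI path_linepath) (simp add: linepath_refl)
    then show ?thesis
      by (intro exI[of _ "linepath x x"]) simp
  qed
  ultimately show ?thesis
    unfolding monodromy_group_def using permutes_id by blast
qed

lemma monodromy_group_comp:
  assumes "\<sigma> \<in> monodromy_group F p" "\<tau> \<in> monodromy_group F p"
  shows "\<tau> \<circ> \<sigma> \<in> monodromy_group F p"
proof -
  obtain \<gamma> where \<gamma>: "\<gamma> \<in> loops_at (- critical_values F) p"
    and l1: "\<And>x. poly F x = p \<Longrightarrow> \<exists>h. is_lift F \<gamma> h \<and> pathstart h = x \<and> pathfinish h = \<sigma> x"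
    and s: "\<sigma> permutes {x. poly F x = p}"
    using assms(1) unfolding monodromy_group_def by blast
  obtain \<delta> where \<delta>: "\<delta> \<in> loops_at (- critical_values F) p"
    and l2: "\<And>x. poly F x = p \<Longrightarrow> \<exists>h. is_lift F \<delta> h \<and> pathstart h = x \<and> pathfinish h = \<tau> x"
    and t: "\<tau> permutes {x. poly F x = p}"
    using assms(2) unfolding monodromy_group_def by blast
  have "\<gamma> +++ \<delta> \<in> loops_at (- critical_values F) p"
    using \<gamma> \<delta> by (auto simp: loops_at_def path_image_join)
  moreover have "\<exists>h. is_lift F (\<gamma> +++ \<delta>) h \<and> pathstart h = x \<and> pathfinish h = (\<tau> \<circ> \<sigma>) x"
    if x: "poly F x = p" for x
  proof -
    obtain h where h: "is_lift F \<gamma> h" "pathstart h = x" "pathfinish h = \<sigma> x"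
      using l1 x by blast
    have "poly F (\<sigma> x) = p"
      using permutes_in_image[OF s, of x] x by simp
    then obtain k where k: "is_lift F \<delta> k" "pathstart k = \<sigma> x" "pathfinish k = \<tau> (\<sigma> x)"
      using l2 by blast
    have "is_lift F (\<gamma> +++ \<delta>) (h +++ k)"
      unfolding is_lift_def
    proof
      show "path (h +++ k)"
        using h k by (simp add: is_lift_def)
      show "\<forall>t\<in>{0..1}. poly F ((h +++ k) t) = (\<gamma> +++ \<delta>) t"
        using h k by (auto simp: is_lift_def joinpaths_def)
    qed
    then show ?thesis
      using h k by (intro exI[of _ "h +++ k"]) auto
  qed
  ultimately show ?thesis
    unfolding monodromy_group_def using permutes_compose[OF s t] by blast
qed

lemma monodromy_group_inv:
  assumes "\<sigma> \<in> monodromy_group F p"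
  shows "inv \<sigma> \<in> monodromy_group F p"
proof -
  obtain \<gamma> where \<gamma>: "\<gamma> \<in> loops_at (- critical_values F) p"
    and l: "\<And>x. poly F x = p \<Longrightarrow> \<exists>h. is_lift F \<gamma> h \<and> pathstart h = x \<and> pathfinish h = \<sigma> x"
    and s: "\<sigma> permutes {x. poly F x = p}"
    using assms unfolding monodromy_group_def by blast
  have "reversepath \<gamma> \<in> loops_at (- critical_values F) p"
    using \<gamma> by (auto simp: loops_at_def)
  moreover have "\<exists>h. is_lift F (reversepath \<gamma>) h \<and> pathstart h = x \<and> pathfinish h = inv \<sigma> x"
    if x: "poly F x = p" for x
  proof -
    have "poly F (inv \<sigma> x) = p"
      using permutes_in_image[OF permutes_inv[OF s], of x] x by simp
    then obtain h where h: "is_lift F \<gamma> h" "pathstart h = inv \<sigma> x" "pathfinish h = \<sigma> (inv \<sigma> x)"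
      using l by blast
    then show ?thesis
      using permutes_inverses[OF s]
      by (intro exI[of _ "reversepath h"]) (auto simp: is_lift_def reversepath_def[abs_def]
          path_reversepath[unfolded reversepath_def] pathstart_def pathfinish_def)
  qed
  ultimately show ?thesis
    unfolding monodromy_group_def using permutes_inv[OF s] by blast
qed

definition tree_level :: "complex poly \<Rightarrow> complex \<Rightarrow> nat \<Rightarrow> complex set" where
  "tree_level f p m = {x. (poly f ^^ m) x = p}"

definition major_branches :: "complex poly \<Rightarrow> complex \<Rightarrow> nat \<Rightarrow> complex set set" where
  "major_branches f p n =
     {{y \<in> tree_level f p n. (poly f ^^ (n - 1)) y = x} | x. x \<in> tree_level f p 1}"

definition level_monodromy_group ::
    "complex poly \<Rightarrow> complex \<Rightarrow> nat \<Rightarrow> (complex \<Rightarrow> complex) set" where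
  "level_monodromy_group f p n = monodromy_group (poly_iterate f n) p"

definition is_block :: "('a \<Rightarrow> 'a) set \<Rightarrow> 'a set \<Rightarrow> 'a set \<Rightarrow> bool" where
  "is_block G S B \<longleftrightarrow> B \<subseteq> S \<and> (\<forall>g\<in>G. g ` B \<inter> B = B \<or> g ` B \<inter> B = {})"

definition is_smallest_block_containing ::
    "('a \<Rightarrow> 'a) set \<Rightarrow> 'a set \<Rightarrow> 'a set \<Rightarrow> 'a set \<Rightarrow> bool" where
  "is_smallest_block_containing G S E B \<longleftrightarrow>
     is_block G S B \<and> E \<subseteq> B \<and> (\<forall>B'. is_block G S B' \<and> E \<subseteq> B' \<longrightarrow> B \<subseteq> B')"

end

theory Submission
  imports Defs "HOL-Complex_Analysis.Complex_Analysis"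
    "HOL-Computational_Algebra.Fundamental_Theorem_Algebra"
begin

text \<open>
  Write \<open>F = f\<^sup>n = f \<circ> g\<close> with \<open>g = f\<^sup>n\<^sup>-\<^sup>1\<close>.  A block \<open>B\<close> spreads by path lifting to every fibre of \<open>F\<close>
  over a regular value, and Liouville's theorem turns it into a decomposition \<open>F = u \<circ> v\<close> in which
  \<open>B\<close> is a fibre of \<open>v\<close>.  Near infinity there is a coordinate \<open>X\<close> with \<open>X\<^sup>N = F\<close>, and the fibres of
  \<open>v\<close> and \<open>g\<close> are those of powers of \<open>X\<close>; hence the equivalence relations "equal under \<open>v\<close>" and
  "equal under \<open>g\<close>" commute, first near infinity and then over every regular value.

  A conservative polynomial with two critical points is indecomposable: in \<open>f = w \<circ> q\<close> every fibre of
  \<open>q\<close> over a critical point of \<open>w\<close> consists of fixed points of \<open>f\<close> with a common value, hence is a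
  single point.  So if \<open>B\<close> meets two major branches, each fibre of \<open>v\<close> is mapped by \<open>g\<close> onto a whole
  fibre of \<open>f\<close>, also over critical values by a limit argument.  But if \<open>u\<close> had a critical point
  \<open>e\<close>, then \<open>v\<^sup>-\<^sup>1(e)\<close> would consist of critical points of \<open>F\<close>, which \<open>g\<close> all maps to the same fixed
  point \<open>u(e)\<close> of \<open>f\<close>, although \<open>f\<close> takes the value \<open>u(e)\<close> elsewhere too.  Hence \<open>u\<close> is linear and
  \<open>B\<close> is the whole fibre.
\<close>

subsection \<open>Polynomial covering maps\<close>

lemma finite_critical_values:
  assumes "degree F > 0"
  shows "finite (critical_values F)"
proof -
  have "pderiv F \<noteq> 0"
    using assms by (simp add: pderiv_eq_0_iff)
  then show ?thesis
    unfolding critical_values_def critical_points_def using poly_roots_finite by blast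
qed

lemma degree_diff_const:
  fixes P :: "'a::ring_1 poly"
  assumes "degree P > 0"
  shows "degree (P - [:w:]) = degree P"
  unfolding diff_conv_add_uminus using assms by (intro degree_add_eq_left) simp

lemma poly_surj_complex:
  fixes P :: "complex poly"
  assumes "degree P > 0"
  obtains z where "poly P z = w"
proof -
  have "degree (P - [:w:]) > 0"
    using assms by (simp add: degree_diff_const)
  then obtain z where "poly (P - [:w:]) z = 0"
    using alg_closed_imp_poly_has_root by blast
  with that show ?thesis by simp
qed

lemma finite_fibre:
  fixes F :: "complex poly"
  assumes "degree F > 0"
  shows "finite {x. poly F x = w}"
proof -
  have "F - [:w:] \<noteq> 0"
    using assms by (metis degree_pCons_0 eq_iff_diff_eq_0 less_irrefl)
  from poly_roots_finite[OF this] show ?thesis by simp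
qed

lemma finite_critical_fibres:
  assumes "degree F > 0"
  shows "finite {x. poly F x \<in> critical_values F}"
proof -
  have "{x. poly F x \<in> critical_values F} = (\<Union>w\<in>critical_values F. {x. poly F x = w})"
    by auto
  then show ?thesis
    using finite_critical_values[OF assms] finite_fibre[OF assms] by simp
qed

lemma card_fibre_le:
  fixes F :: "complex poly"
  assumes "degree F > 0"
  shows "card {x. poly F x = w} \<le> degree F"
proof -
  have "F - [:w:] \<noteq> 0"
    using assms by (metis degree_pCons_0 eq_iff_diff_eq_0 less_irrefl)
  from card_poly_roots_bound[OF this]
  have "card {x. poly F x = w} \<le> degree (F - [:w:])" by simp
  also have "\<dots> \<le> degree F"
    by (rule degree_diff_le) auto
  finally show ?thesis .
qed

text \<open>\<open>F - [:p:]\<close> has the same derivative as \<open>F\<close>, so over a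
  noncritical value all its roots are simple and it is a constant times a product of distinct linear
  factors, one for each point of the fibre.\<close>

lemma card_fibre_regular:
  assumes "degree F > 0" and "p \<notin> critical_values F"
  shows "card {x. poly F x = p} = degree F"
proof -
  define P where "P = F - [:p:]"
  have roots: "{x. poly P x = 0} = {x. poly F x = p}"
    by (auto simp: P_def)
  have deg: "degree P = degree F"
    using assms(1) by (simp add: P_def degree_diff_const)
  have "pderiv P = pderiv F"
    by (simp add: P_def pderiv_diff)
  then have "rsquarefree P"
    using assms(2)
    by (auto simp: rsquarefree_roots critical_values_def critical_points_def P_def)
  then have "degree P = degree (smult (lead_coeff P) (\<Prod>z|poly P z = 0. [:-z, 1:]))"
    by (simp add: complex_poly_decompose_rsquarefree)
  also have "\<dots> = degree (\<Prod>z|poly P z = 0. [:-z, 1:])"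
    using deg assms(1) by (subst degree_smult_eq) (metis degree_0 leading_coeff_0_iff less_irrefl)
  also have "\<dots> = card {z. poly P z = 0}"
    by (subst degree_prod_eq_sum_degree) auto
  finally show ?thesis
    using deg roots by simp
qed

text \<open>At each point of the fibre the derivative is nonzero, so \<open>F\<close> has a local
  holomorphic inverse there; the fibre is finite, so one disc around \<open>p\<close> serves all its
  points. The inverses exhaust a nearby fibre by counting: both fibres have \<open>degree F\<close>
  points.\<close>

lemma regular_local_sections:
  fixes F :: "complex poly"
  assumes "degree F > 0" and "p \<notin> critical_values F"
  obtains r \<eta> where "r > 0" "ball p r \<inter> critical_values F = {}"
    "\<And>z. poly F z = p \<Longrightarrow> \<eta> z p = z"
    "\<And>z. poly F z = p \<Longrightarrow> \<eta> z holomorphic_on ball p r"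
    "\<And>z w. poly F z = p \<Longrightarrow> w \<in> ball p r \<Longrightarrow> poly F (\<eta> z w) = w"
    "\<And>w. w \<in> ball p r \<Longrightarrow> bij_betw (\<lambda>z. \<eta> z w) {z. poly F z = p} {z. poly F z = w}"
proof -
  define Z where "Z = {z. poly F z = p}"
  have hol: "poly F holomorphic_on A" for A
    using poly_holomorphic_on[OF holomorphic_on_ident] by simp
  have finZ: "finite Z"
    unfolding Z_def by (rule finite_fibre[OF assms(1)])
  have "\<exists>\<rho>>0. inj_on (poly F) (ball z \<rho>) \<and> (\<forall>x\<in>Z. x \<noteq> z \<longrightarrow> 2 * \<rho> \<le> dist z x)"
    if z: "z \<in> Z" for z
  proof -
    have "deriv (poly F) z \<noteq> 0"
      using z assms(2) DERIV_imp_deriv[OF poly_DERIV[of F z]]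
      by (auto simp: Z_def critical_values_def critical_points_def)
    then obtain r where r: "r > 0" "inj_on (poly F) (ball z r)"
      using has_complex_derivative_locally_injective[of "poly F" UNIV z]
      by (metis UNIV_I hol open_UNIV)
    obtain d where d: "d > 0" "\<forall>x\<in>Z. x \<noteq> z \<longrightarrow> d \<le> dist z x"
      using finite_set_avoid[OF finZ, of z] by blast
    \<comment> \<open>Radii of at most half the separation \<open>d\<close> make the discs around
      different fibre points disjoint.\<close>
    show ?thesis
      using r d by (intro exI[of _ "min r (d / 2)"]) (force intro: inj_on_subset)
  qed
  then obtain \<rho> where \<rho>: "\<And>z. z \<in> Z \<Longrightarrow> \<rho> z > 0"
      "\<And>z. z \<in> Z \<Longrightarrow> inj_on (poly F) (ball z (\<rho> z))"
      "\<And>z x. z \<in> Z \<Longrightarrow> x \<in> Z \<Longrightarrow> x \<noteq> z \<Longrightarrow> 2 * \<rho> z \<le> dist z x"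
    by metis
  have disj: "z = z'" if "z \<in> Z" "z' \<in> Z" "x \<in> ball z (\<rho> z)" "x \<in> ball z' (\<rho> z')" for z z' x
  proof (rule ccontr)
    assume "z \<noteq> z'"
    then have "2 * \<rho> z \<le> dist z z'" "2 * \<rho> z' \<le> dist z z'"
      using \<rho>(3) that(1,2) by (metis dist_commute)+
    moreover have "dist z z' < \<rho> z + \<rho> z'"
      using that(3,4) dist_triangle[of z z' x] by (simp add: dist_commute)
    ultimately show False by linarith
  qed
  define D where "D = (\<Inter>z\<in>Z. poly F ` ball z (\<rho> z)) \<inter> - critical_values F"
  have "open (\<Inter>z\<in>Z. poly F ` ball z (\<rho> z))"
    by (intro open_INT[OF finZ] ballI open_mapping_thm3[OF hol]) (use \<rho> in auto)
  moreover have "closed (critical_values F)"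
    using finite_critical_values[OF assms(1)] by (rule finite_imp_closed)
  ultimately have "open D"
    unfolding D_def by (simp add: open_Int open_Compl)
  moreover have "p \<in> D"
    using assms(2) \<rho>(1) by (force simp: D_def Z_def)
  ultimately obtain r where r: "r > 0" "ball p r \<subseteq> D"
    using open_contains_ball by blast
  have "\<exists>g. g holomorphic_on poly F ` ball z (\<rho> z) \<and> (\<forall>x\<in>ball z (\<rho> z). g (poly F x) = x)"
    if "z \<in> Z" for z
    by (rule holomorphic_has_inverse[OF hol open_ball \<rho>(2)[OF that]]) blast
  then obtain \<eta> where \<eta>: "\<And>z. z \<in> Z \<Longrightarrow> \<eta> z holomorphic_on poly F ` ball z (\<rho> z)"
      "\<And>z x. z \<in> Z \<Longrightarrow> x \<in> ball z (\<rho> z) \<Longrightarrow> \<eta> z (poly F x) = x"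
    by metis
  have sub: "ball p r \<subseteq> poly F ` ball z (\<rho> z)" if "z \<in> Z" for z
    using r(2) that by (auto simp: D_def)
  have sec: "poly F (\<eta> z w) = w" "\<eta> z w \<in> ball z (\<rho> z)" if "z \<in> Z" "w \<in> ball p r" for z w
    using sub[OF that(1)] that(2) \<eta>(2)[OF that(1)] by (force simp: subset_iff image_iff)+
  show ?thesis
  proof
    show "r > 0" by fact
    show "ball p r \<inter> critical_values F = {}"
      using r(2) by (auto simp: D_def)
    show "\<eta> z p = z" if "poly F z = p" for z
      using \<eta>(2)[of z z] \<rho>(1)[of z] that by (auto simp: Z_def)
    show "\<eta> z holomorphic_on ball p r" if "poly F z = p" for z
    proof (rule holomorphic_on_subset)
      show "\<eta> z holomorphic_on poly F ` ball z (\<rho> z)" "ball p r \<subseteq> poly F ` ball z (\<rho> z)"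
        using \<eta>(1) sub that by (auto simp: Z_def)
    qed
    show "poly F (\<eta> z w) = w" if "poly F z = p" "w \<in> ball p r" for z w
      using sec that by (auto simp: Z_def)
    show "bij_betw (\<lambda>z. \<eta> z w) {z. poly F z = p} {z. poly F z = w}" if w: "w \<in> ball p r" for w
    proof -
      have inj: "inj_on (\<lambda>z. \<eta> z w) Z"
        using disj sec(2) w by (intro inj_onI) metis
      have "(\<lambda>z. \<eta> z w) ` Z = {z. poly F z = w}"
      proof (rule card_subset_eq)
        show "finite {z. poly F z = w}"
          by (rule finite_fibre[OF assms(1)])
        show "(\<lambda>z. \<eta> z w) ` Z \<subseteq> {z. poly F z = w}"
          using sec w by auto
        have "w \<notin> critical_values F"
          using r(2) w by (auto simp: D_def)
        then show "card ((\<lambda>z. \<eta> z w) ` Z) = card {z. poly F z = w}"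
          using card_fibre_regular[OF assms(1)] assms(2) card_image[OF inj] by (simp add: Z_def)
      qed
      with inj show ?thesis
        by (simp add: bij_betw_def Z_def)
    qed
  qed
qed

text \<open>The disc of \<open>regular_local_sections\<close> is evenly covered, its sheets being
  the images of the local sections. Path lifting then comes from the general theory of covering
  spaces.\<close>

lemma covering_space_poly:
  fixes F :: "complex poly"
  assumes "degree F > 0"
  shows "covering_space {x. poly F x \<notin> critical_values F} (poly F) (- critical_values F)"
  unfolding covering_space_def
proof (intro conjI ballI)
  let ?C = "{x. poly F x \<notin> critical_values F}"
  show "continuous_on ?C (poly F)"
    by (intro continuous_intros)
  show "poly F ` ?C = - critical_values F"
  proof
    show "- critical_values F \<subseteq> poly F ` ?C"
    proof
      fix w assume "w \<in> - critical_values F"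
      moreover obtain z where "poly F z = w"
        using poly_surj_complex[OF assms] .
      ultimately show "w \<in> poly F ` ?C" by auto
    qed
  qed auto
  fix p assume p: "p \<in> - critical_values F"
  then obtain r \<eta> where r: "r > 0" "ball p r \<inter> critical_values F = {}"
    and hol: "\<And>z. poly F z = p \<Longrightarrow> \<eta> z holomorphic_on ball p r"
    and sec: "\<And>z w. poly F z = p \<Longrightarrow> w \<in> ball p r \<Longrightarrow> poly F (\<eta> z w) = w"
    and bij: "\<And>w. w \<in> ball p r \<Longrightarrow> bij_betw (\<lambda>z. \<eta> z w) {z. poly F z = p} {z. poly F z = w}"
    using regular_local_sections[OF assms, of p] by (metis ComplD)
  define \<V> where "\<V> = (\<lambda>z. \<eta> z ` ball p r) ` {z. poly F z = p}"
  have "\<Union>\<V> = ?C \<inter> poly F -` ball p r"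
  proof (intro equalityI subsetI)
    fix x assume "x \<in> \<Union>\<V>"
    then show "x \<in> ?C \<inter> poly F -` ball p r"
      using sec r(2) by (auto simp: \<V>_def)
  next
    fix x assume "x \<in> ?C \<inter> poly F -` ball p r"
    then have w: "poly F x \<in> ball p r" by auto
    have "x \<in> (\<lambda>z. \<eta> z (poly F x)) ` {z. poly F z = p}"
      using bij_betw_imp_surj_on[OF bij[OF w]] by simp
    then obtain z where "poly F z = p" "x = \<eta> z (poly F x)"
      by blast
    then show "x \<in> \<Union>\<V>"
      using w by (auto simp: \<V>_def)
  qed
  moreover have "openin (top_of_set ?C) U" if "U \<in> \<V>" for U
  proof -
    obtain z where z: "poly F z = p" "U = \<eta> z ` ball p r"
      using \<open>U \<in> \<V>\<close> by (auto simp: \<V>_def)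
    have "inj_on (\<eta> z) (ball p r)"
      using sec[OF z(1)] by (metis inj_onI)
    then have "open U"
      unfolding z(2) using open_mapping_thm3[OF hol[OF z(1)]] by simp
    moreover have "U \<subseteq> ?C"
      using z sec r(2) by auto
    ultimately show ?thesis
      by (intro open_subset)
  qed
  moreover have "pairwise disjnt \<V>"
  proof (clarsimp simp: pairwise_def \<V>_def disjnt_iff)
    fix z z' w w'
    assume *: "\<eta> z ` ball (poly F z) r \<noteq> \<eta> z' ` ball (poly F z) r"
      "p = poly F z" "poly F z' = poly F z"
      "dist (poly F z) w < r" "\<eta> z w = \<eta> z' w'" "dist (poly F z) w' < r"
    then have "w = w'"
      using sec[of z w] sec[of z' w'] by simp
    then have "z = z'"
      using bij[of w] * by (auto simp: bij_betw_def inj_on_def)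
    then show False using *(1) by simp
  qed
  moreover have "\<exists>q. homeomorphism U (ball p r) (poly F) q" if "U \<in> \<V>" for U
  proof -
    obtain z where z: "poly F z = p" "U = \<eta> z ` ball p r"
      using \<open>U \<in> \<V>\<close> by (auto simp: \<V>_def)
    have "homeomorphism U (ball p r) (poly F) (\<eta> z)"
      unfolding homeomorphism_def z(2)
      using sec[OF z(1)] holomorphic_on_imp_continuous_on[OF hol[OF z(1)]]
      by (auto simp: image_image intro!: continuous_intros)
    then show ?thesis by blast
  qed
  ultimately have "\<Union>\<V> = ?C \<inter> poly F -` ball p r \<and> (\<forall>u\<in>\<V>. openin (top_of_set ?C) u) \<and>
           pairwise disjnt \<V> \<and> (\<forall>u\<in>\<V>. \<exists>q. homeomorphism u (ball p r) (poly F) q)"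
    by blast
  moreover have "openin (top_of_set (- critical_values F)) (ball p r)"
    using r(2) by (intro open_subset) auto
  moreover have "p \<in> ball p r"
    using r(1) by simp
  ultimately show "\<exists>T. p \<in> T \<and> openin (top_of_set (- critical_values F)) T \<and>
      (\<exists>v. \<Union>v = ?C \<inter> poly F -` T \<and> (\<forall>u\<in>v. openin (top_of_set ?C) u) \<and>
           pairwise disjnt v \<and> (\<forall>u\<in>v. \<exists>q. homeomorphism u T (poly F) q))"
    by blast
qed

section \<open>Lifting of paths that avoid the critical values\<close>

definition regular_path :: "complex poly \<Rightarrow> (real \<Rightarrow> complex) \<Rightarrow> complex \<Rightarrow> complex \<Rightarrow> bool" where
  "regular_path F \<gamma> p q \<longleftrightarrow> path \<gamma> \<and> path_image \<gamma> \<subseteq> - critical_values F \<and>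
     pathstart \<gamma> = p \<and> pathfinish \<gamma> = q"

text \<open>A relation between end points, so that reversing and joining paths act on it directly;
  existence and uniqueness of lifts are proved separately for regular paths.\<close>

definition transports :: "complex poly \<Rightarrow> (real \<Rightarrow> complex) \<Rightarrow> complex \<Rightarrow> complex \<Rightarrow> bool" where
  "transports F \<gamma> x y \<longleftrightarrow> (\<exists>h. is_lift F \<gamma> h \<and> pathstart h = x \<and> pathfinish h = y)"

lemma regular_path_join:
  "regular_path F \<gamma> p q \<Longrightarrow> regular_path F \<delta> q r \<Longrightarrow> regular_path F (\<gamma> +++ \<delta>) p r"
  by (auto simp: regular_path_def path_image_join)

lemma regular_path_reverse:
  "regular_path F \<gamma> p q \<Longrightarrow> regular_path F (reversepath \<gamma>) q p"
  by (auto simp: regular_path_def)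

lemma regular_path_exists:
  assumes "degree F > 0" "p \<notin> critical_values F" "q \<notin> critical_values F"
  obtains \<gamma> where "regular_path F \<gamma> p q"
proof -
  have "path_connected (- critical_values F)"
    using finite_critical_values[OF assms(1)]
    by (intro path_connected_complement_countable) (auto intro: countable_finite)
  then show ?thesis
    using assms that unfolding path_connected_def regular_path_def by (metis ComplI)
qed

lemma is_lift_regular_image:
  assumes "regular_path F \<gamma> p q" "is_lift F \<gamma> h" "t \<in> {0..1}"
  shows "poly F (h t) \<notin> critical_values F"
  using assms by (force simp: regular_path_def is_lift_def path_image_def)

lemma transports_fibre:
  assumes "regular_path F \<gamma> p q" "transports F \<gamma> x y"
  shows "poly F x = p" "poly F y = q"
  using assms
  by (auto simp: transports_def regular_path_def is_lift_def pathstart_def pathfinish_def)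

lemma transports_exists:
  assumes "degree F > 0" "regular_path F \<gamma> p q" "poly F x = p"
  obtains y where "transports F \<gamma> x y"
proof -
  have "p \<notin> critical_values F"
    using assms(2) pathstart_in_path_image[of \<gamma>] by (auto simp: regular_path_def)
  then obtain h where "path h" "pathstart h = x" "\<And>t. t \<in> {0..1} \<Longrightarrow> poly F (h t) = \<gamma> t"
    using covering_space_lift_path_strong[OF covering_space_poly[OF assms(1)], of x \<gamma>] assms(2,3)
    unfolding regular_path_def by (metis mem_Collect_eq)
  then show ?thesis
    using that unfolding transports_def is_lift_def by blast
qed

lemma transports_unique:
  assumes "degree F > 0" "regular_path F \<gamma> p q" "transports F \<gamma> x y" "transports F \<gamma> x y'"
  shows "y = y'"
proof -
  obtain h h' where h: "is_lift F \<gamma> h" "pathstart h = x" "pathfinish h = y"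
    and h': "is_lift F \<gamma> h'" "pathstart h' = x" "pathfinish h' = y'"
    using assms(3,4) unfolding transports_def by blast
  have "h 1 = h' 1"
  proof (rule covering_space_lift_unique[OF covering_space_poly[OF assms(1)],
        where a = 0 and T = "{0..1}" and f = \<gamma>])
    show "h 0 = h' 0"
      using h h' by (simp add: pathstart_def)
    show "continuous_on {0..1} \<gamma>" "\<gamma> \<in> {0..1} \<rightarrow> - critical_values F"
      using assms(2) by (auto simp: regular_path_def path_def path_image_def)
    show "continuous_on {0..1} h" "continuous_on {0..1} h'"
      using h h' by (auto simp: is_lift_def path_def)
    show "h \<in> {0..1} \<rightarrow> {x. poly F x \<notin> critical_values F}"
      "h' \<in> {0..1} \<rightarrow> {x. poly F x \<notin> critical_values F}"
      using is_lift_regular_image[OF assms(2)] h h' by auto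
    show "\<gamma> x = poly F (h x)" "\<gamma> x = poly F (h' x)" if "x \<in> {0..1}" for x
      using h h' that by (auto simp: is_lift_def)
  qed auto
  then show ?thesis
    using h h' by (simp add: pathfinish_def)
qed

lemma transports_join:
  assumes "transports F \<gamma> x y" "transports F \<delta> y z"
  shows "transports F (\<gamma> +++ \<delta>) x z"
proof -
  obtain h k where h: "is_lift F \<gamma> h" "pathstart h = x" "pathfinish h = y"
    and k: "is_lift F \<delta> k" "pathstart k = y" "pathfinish k = z"
    using assms unfolding transports_def by blast
  have "is_lift F (\<gamma> +++ \<delta>) (h +++ k)"
    unfolding is_lift_def
  proof
    show "path (h +++ k)"
      using h k by (simp add: is_lift_def)
    show "\<forall>t\<in>{0..1}. poly F ((h +++ k) t) = (\<gamma> +++ \<delta>) t"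
      using h k by (auto simp: is_lift_def joinpaths_def)
  qed
  with h k show ?thesis
    unfolding transports_def by (intro exI[of _ "h +++ k"]) simp
qed

lemma transports_reverse:
  assumes "transports F \<gamma> x y"
  shows "transports F (reversepath \<gamma>) y x"
proof -
  obtain h where h: "is_lift F \<gamma> h" "pathstart h = x" "pathfinish h = y"
    using assms unfolding transports_def by blast
  have "is_lift F (reversepath \<gamma>) (reversepath h)"
    using h by (auto simp: is_lift_def) (auto simp: reversepath_def)
  with h show ?thesis
    unfolding transports_def by (intro exI[of _ "reversepath h"]) simp
qed

lemma transports_inj:
  assumes "degree F > 0" "regular_path F \<gamma> p q" "transports F \<gamma> x y" "transports F \<gamma> x' y"
  shows "x = x'"
  using transports_unique[OF assms(1) regular_path_reverse[OF assms(2)]] assms(3,4)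
  by (blast intro: transports_reverse)

lemma transport_map:
  assumes "degree F > 0" "regular_path F \<gamma> p q"
  obtains \<phi> where "bij_betw \<phi> {x. poly F x = p} {x. poly F x = q}"
    "\<And>x. poly F x = p \<Longrightarrow> transports F \<gamma> x (\<phi> x)"
proof -
  have "\<forall>x. \<exists>y. poly F x = p \<longrightarrow> transports F \<gamma> x y"
    using transports_exists[OF assms] by blast
  then obtain \<phi> where \<phi>: "\<And>x. poly F x = p \<Longrightarrow> transports F \<gamma> x (\<phi> x)"
    by metis
  have "bij_betw \<phi> {x. poly F x = p} {x. poly F x = q}"
  proof (rule bij_betw_imageI)
    show "inj_on \<phi> {x. poly F x = p}"
      using \<phi> transports_inj[OF assms] by (intro inj_onI) (metis mem_Collect_eq)
    show "\<phi> ` {x. poly F x = p} = {x. poly F x = q}"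
    proof (intro equalityI subsetI)
      fix y assume "y \<in> {x. poly F x = q}"
      then obtain x where "transports F (reversepath \<gamma>) y x"
        using transports_exists[OF assms(1) regular_path_reverse[OF assms(2)]] by blast
      then have x: "transports F \<gamma> x y"
        using transports_reverse by fastforce
      then have "poly F x = p"
        using transports_fibre[OF assms(2)] by blast
      moreover from this have "y = \<phi> x"
        using \<phi> transports_unique[OF assms x] by blast
      ultimately show "y \<in> \<phi> ` {x. poly F x = p}"
        by blast
    qed (use \<phi> transports_fibre[OF assms(2)] in blast)
  qed
  with \<phi> that show ?thesis by blast
qed

text \<open>Deleting the finitely many points over critical values leaves the plane path connected,
  and a path from \<open>x\<close> to \<open>y\<close> there is itself a lift of its image under
  \<open>F\<close>. This lets every point over a regular value be moved into the block.\<close>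

lemma transports_transitive:
  assumes "degree F > 0" "p \<notin> critical_values F" "poly F x = p"
    "q \<notin> critical_values F" "poly F y = q"
  obtains \<gamma> where "regular_path F \<gamma> p q" "transports F \<gamma> x y"
proof -
  have "path_connected (- {x. poly F x \<in> critical_values F})"
    using finite_critical_fibres[OF assms(1)]
    by (intro path_connected_complement_countable) (auto intro: countable_finite)
  moreover have "x \<in> - {x. poly F x \<in> critical_values F}" "y \<in> - {x. poly F x \<in> critical_values F}"
    using assms by auto
  ultimately obtain h where h: "path h" "path_image h \<subseteq> - {x. poly F x \<in> critical_values F}"
      "pathstart h = x" "pathfinish h = y"
    unfolding path_connected_def by blast
  show ?thesis
  proof
    have "path (poly F \<circ> h)"
      using h(1) by (intro path_continuous_image) (auto intro: continuous_intros)
    then show "regular_path F (poly F \<circ> h) p q"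
      using h assms by (auto simp: regular_path_def path_image_compose pathstart_compose pathfinish_compose)
    show "transports F (poly F \<circ> h) x y"
      using h by (auto simp: transports_def is_lift_def intro!: exI[of _ h])
  qed
qed

section \<open>Transport, composition and blocks\<close>

lemma critical_values_pcompose:
  assumes "degree v > 0"
  shows "critical_values u \<subseteq> critical_values (pcompose u v)"
proof
  fix w assume "w \<in> critical_values u"
  then obtain e where e: "poly (pderiv u) e = 0" "w = poly u e"
    by (auto simp: critical_values_def critical_points_def)
  obtain z where "poly v z = e"
    using poly_surj_complex[OF assms] .
  then show "w \<in> critical_values (pcompose u v)"
    using e by (auto simp: critical_values_def critical_points_def poly_pcompose pderiv_pcompose
        intro!: image_eqI[of _ _ z])
qed

lemma regular_path_pcompose:
  assumes "degree v > 0" "regular_path (pcompose u v) \<gamma> p q"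
  shows "regular_path u \<gamma> p q"
  using assms(2) critical_values_pcompose[OF assms(1), of u] by (auto simp: regular_path_def)

lemma transports_pcompose:
  assumes "transports (pcompose u v) \<gamma> x y"
  shows "transports u \<gamma> (poly v x) (poly v y)"
proof -
  obtain h where h: "is_lift (pcompose u v) \<gamma> h" "pathstart h = x" "pathfinish h = y"
    using assms unfolding transports_def by blast
  have "path (poly v \<circ> h)"
    using h by (intro path_continuous_image) (auto simp: is_lift_def intro: continuous_intros)
  with h show ?thesis
    unfolding transports_def
    by (intro exI[of _ "poly v \<circ> h"])
      (auto simp: is_lift_def poly_pcompose pathstart_compose pathfinish_compose)
qed

text \<open>\<open>v\<close> maps lifts through \<open>pcompose u v\<close> to lifts through
  \<open>u\<close>, and these are determined by their starting points and, reversed, by their end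
  points.\<close>

lemma transports_pcompose_eq_iff:
  assumes "degree u > 0" "degree v > 0" "regular_path (pcompose u v) \<gamma> p q"
    "transports (pcompose u v) \<gamma> x x'" "transports (pcompose u v) \<gamma> y y'"
  shows "poly v x = poly v y \<longleftrightarrow> poly v x' = poly v y'"
  using transports_unique[OF assms(1) regular_path_pcompose[OF assms(2,3)]]
    transports_inj[OF assms(1) regular_path_pcompose[OF assms(2,3)]]
    transports_pcompose[OF assms(4)] transports_pcompose[OF assms(5)] by metis

text \<open>The loop \<open>\<gamma>\<close> induces an element of the monodromy group that takes
  \<open>b\<close> to \<open>b'\<close>; it moves \<open>B\<close> to a set meeting
  \<open>B\<close>, hence onto \<open>B\<close>.\<close>

lemma block_transports_iff:
  assumes "degree F > 0" "is_block (monodromy_group F p) {x. poly F x = p} B"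
    and "regular_path F \<gamma> p p" "transports F \<gamma> b b'" "b \<in> B" "b' \<in> B" "transports F \<gamma> x x'"
  shows "x \<in> B \<longleftrightarrow> x' \<in> B"
proof -
  let ?Z = "{x. poly F x = p}"
  obtain \<phi> where \<phi>: "bij_betw \<phi> ?Z ?Z" "\<And>x. poly F x = p \<Longrightarrow> transports F \<gamma> x (\<phi> x)"
    using transport_map[OF assms(1,3)] by blast
  define \<sigma> where "\<sigma> x = (if x \<in> ?Z then \<phi> x else x)" for x
  have \<sigma>: "\<sigma> permutes ?Z"
    using \<phi>(1) by (intro bij_imp_permutes) (auto simp: \<sigma>_def bij_betw_def inj_on_def)
  have eq: "\<sigma> y = y'" if "transports F \<gamma> y y'" for y y'
    using \<phi>(2) transports_unique[OF assms(1,3) that] transports_fibre[OF assms(3) that]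
    by (auto simp: \<sigma>_def)
  have "\<sigma> \<in> monodromy_group F p"
    unfolding monodromy_group_def
  proof (intro CollectI conjI \<sigma> bexI[of _ \<gamma>] allI impI)
    show "\<gamma> \<in> loops_at (- critical_values F) p"
      using assms(3) by (auto simp: loops_at_def regular_path_def)
    show "\<exists>h. is_lift F \<gamma> h \<and> pathstart h = x \<and> pathfinish h = \<sigma> x" if "poly F x = p" for x
      using \<phi>(2)[OF that] that by (simp add: \<sigma>_def transports_def)
  qed
  then have "\<sigma> ` B \<inter> B = B \<or> \<sigma> ` B \<inter> B = {}" and BZ: "B \<subseteq> ?Z"
    using assms(2) by (auto simp: is_block_def)
  moreover have "b' \<in> \<sigma> ` B \<inter> B"
    using eq[OF assms(4)] assms(5,6) by auto
  \<comment> \<open>The block condition gives only this inclusion; finiteness of \<open>B\<close>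
    turns it into an equality.\<close>
  ultimately have sub: "B \<subseteq> \<sigma> ` B"
    by blast
  have inj: "inj \<sigma>"
    using \<sigma> by (rule permutes_inj)
  have "finite B"
    using BZ finite_fibre[OF assms(1)] finite_subset by blast
  then have "\<sigma> ` B = B"
    using sub card_subset_eq[OF _ sub] card_image[of \<sigma> B] inj_on_subset[OF inj] by (simp add: inj_on_subset)
  then show ?thesis
    using eq[OF assms(7)] inj by (metis inj_image_mem_iff)
qed

subsection \<open>Blocks and decompositions\<close>

lemma prod_linear_dvd:
  fixes P :: "'a::field poly"
  assumes "finite K" "\<And>k. k \<in> K \<Longrightarrow> poly P k = 0"
  shows "(\<Prod>k\<in>K. [:-k, 1:]) dvd P"
  using assms
proof (induction K rule: finite_induct)
  case (insert k K)
  then obtain Q where Q: "P = (\<Prod>k\<in>K. [:-k, 1:]) * Q"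
    by (metis dvdE insertCI)
  moreover have "poly (\<Prod>k\<in>K. [:-k, 1:]) k \<noteq> 0"
    using insert.hyps by (auto simp: poly_prod)
  ultimately have "poly Q k = 0"
    using insert.prems[of k] by simp
  then have "[:-k, 1:] dvd Q"
    by (simp add: poly_eq_0_iff_dvd)
  then have "(\<Prod>k\<in>K. [:-k, 1:]) * [:-k, 1:] dvd P"
    unfolding Q by (rule mult_dvd_mono[OF dvd_refl])
  then show ?case
    unfolding prod.insert[OF insert.hyps] by (simp only: mult.commute)
qed simp

lemma degree_prod_linear:
  "degree (\<Prod>k\<in>K. [:-k, 1::'a::field:]) = card K"
  by (subst degree_prod_eq_sum_degree) auto

text \<open>Division by \<open>v - [:t:]\<close>: the remainder of \<open>P - [:poly P x0:]\<close>
  has degree below \<open>degree v\<close> but vanishes on the \<open>degree v\<close> points of a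
  good fibre, so it is zero. The quotient is constant on all other good fibres and, unless it is
  zero, has smaller degree, so induction makes it a polynomial in \<open>v\<close>.\<close>

lemma pcompose_if_constant_on_fibres:
  fixes v P :: "complex poly"
  assumes "degree v > 0"
    and "infinite {t. card {z. poly v z = t} = degree v \<and>
                      (\<forall>x y. poly v x = t \<longrightarrow> poly v y = t \<longrightarrow> poly P x = poly P y)}"
      (is "infinite (?T P)")
  obtains u where "P = pcompose u v"
  using assms(2)
proof (induction "degree P" arbitrary: P thesis rule: less_induct)
  case less
  obtain t where t: "t \<in> ?T P"
    using infinite_imp_nonempty[OF less.prems(2)] by blast
  then have t_card: "card {z. poly v z = t} = degree v"
    by blast
  obtain x0 where x0: "poly v x0 = t"
    using poly_surj_complex[OF assms(1)] .
  define d where "d = v - [:t:]"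
  have deg_d: "degree d = degree v"
    unfolding d_def by (rule degree_diff_const[OF assms(1)])
  have "(P - [:poly P x0:]) mod d = 0" (is "?R = 0")
  proof (rule ccontr)
    assume "?R \<noteq> 0"
    have "{z. poly v z = t} \<subseteq> {z. poly ?R z = 0}"
    proof
      fix z assume z: "z \<in> {z. poly v z = t}"
      then have "poly P z = poly P x0"
        using t x0 by blast
      then have "poly (P - [:poly P x0:]) z = 0"
        by simp
      moreover have "poly d z = 0"
        using z by (simp add: d_def)
      moreover have "P - [:poly P x0:] = (P - [:poly P x0:]) div d * d + ?R"
        by simp
      then have "poly (P - [:poly P x0:]) z = poly ((P - [:poly P x0:]) div d) z * poly d z + poly ?R z"
        by (metis poly_add poly_mult)
      ultimately have "poly ?R z = 0"
        by simp
      then show "z \<in> {z. poly ?R z = 0}"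
        by simp
    qed
    then have "degree v \<le> card {z. poly ?R z = 0}"
      unfolding t_card[symmetric] by (rule card_mono[OF poly_roots_finite[OF \<open>?R \<noteq> 0\<close>]])
    also have "\<dots> \<le> degree ?R"
      by (rule card_poly_roots_bound[OF \<open>?R \<noteq> 0\<close>])
    also have "\<dots> < degree d"
      using \<open>?R \<noteq> 0\<close> assms(1) deg_d by (intro degree_mod_less') auto
    finally show False
      using deg_d by simp
  qed
  then obtain P1 where P1: "P - [:poly P x0:] = d * P1"
    by (metis dvd_eq_mod_eq_0 dvdE)
  define c where "c = poly P x0"
  have P: "P = [:c:] + (v - [:t:]) * P1"
    using P1 by (simp add: d_def c_def algebra_simps)
  then have polyP: "poly P z = c + (poly v z - t) * poly P1 z" for z
    by (subst P) simp
  show ?case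
  proof (cases "P1 = 0")
    case True
    then have "P = [:c:]"
      using P by simp
    then have "P = pcompose [:c:] v"
      by (metis pcompose_const)
    then show ?thesis
      by (rule less.prems(1))
  next
    case False
    have "d \<noteq> 0"
      using assms(1) deg_d by auto
    then have "degree (P - [:poly P x0:]) = degree v + degree P1"
      using False by (simp add: P1 degree_mult_eq deg_d)
    moreover have "degree (P - [:poly P x0:]) \<le> degree P"
      by (rule degree_diff_le) auto
    ultimately have deg: "degree P1 < degree P"
      using assms(1) by linarith
    have "?T P - {t} \<subseteq> ?T P1"
    proof
      fix s assume s: "s \<in> ?T P - {t}"
      have "poly P1 x = poly P1 y" if "poly v x = s" "poly v y = s" for x y
      proof -
        have "poly P x = c + (s - t) * poly P1 x" "poly P y = c + (s - t) * poly P1 y"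
          using that by (simp_all add: polyP)
        moreover have "poly P x = poly P y"
          using s that by blast
        ultimately show ?thesis
          using s by simp
      qed
      moreover have "card {z. poly v z = s} = degree v"
        using s by blast
      ultimately show "s \<in> ?T P1"
        by blast
    qed
    moreover have "infinite (?T P - {t})"
      using less.prems(2) by simp
    ultimately have "infinite (?T P1)"
      using finite_subset by blast
    then obtain u1 where "P1 = pcompose u1 v"
      using less.hyps[OF deg] by blast
    then have "P = pcompose ([:c:] + [:-t, 1:] * u1) v"
      by (subst P) (simp add: pcompose_add pcompose_mult pcompose_pCons pcompose_diff pcompose_smult algebra_simps)
    then show ?thesis
      by (rule less.prems(1))
  qed
qed

section \<open>Growth of polynomials and size of fibres\<close>

text \<open>The reversed polynomial at \<open>inverse z\<close> is \<open>F\<close> divided by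
  \<open>z ^ degree F\<close>, and it is close to the leading coefficient once \<open>z\<close> is
  large.\<close>

lemma poly_growth:
  fixes F :: "complex poly"
  assumes "degree F > 0"
  obtains R where "R > 0"
    "\<And>z. norm z > R \<Longrightarrow> norm (lead_coeff F) / 2 * norm z ^ degree F \<le> norm (poly F z)"
    "\<And>z. norm z > R \<Longrightarrow> norm (poly F z) \<le> 2 * norm (lead_coeff F) * norm z ^ degree F"
proof -
  let ?L = "norm (lead_coeff F)"
  have L: "?L > 0"
    using assms by auto
  have "isCont (poly (reflect_poly F)) 0"
    by simp
  then obtain d where d: "d > 0"
    "\<And>t. norm t < d \<Longrightarrow> norm (poly (reflect_poly F) t - lead_coeff F) < ?L / 2"
    using L unfolding continuous_at_eps_delta
    by (auto simp: dist_norm dest!: spec[of _ "?L / 2"])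
  show ?thesis
  proof
    show "1 / d > 0"
      using d by simp
    fix z :: complex assume "norm z > 1 / d"
    then have "norm z > 0"
      using d(1) by (meson order.strict_trans zero_less_divide_1_iff)
    with \<open>norm z > 1 / d\<close> have z: "z \<noteq> 0" "norm (inverse z) < d"
      using d(1) by (auto simp: norm_divide field_simps)
    have eq: "norm (poly (reflect_poly F) (inverse z)) * norm z ^ degree F = norm (poly F z)"
      using z by (simp add: poly_reflect_poly_nz norm_mult norm_divide norm_power field_simps)
    have "\<bar>norm (poly (reflect_poly F) (inverse z)) - ?L\<bar> < ?L / 2"
      using d(2)[OF z(2)] norm_triangle_ineq3 by (rule order.strict_trans1[rotated])
    then have *: "?L / 2 \<le> norm (poly (reflect_poly F) (inverse z))"
      "norm (poly (reflect_poly F) (inverse z)) \<le> 2 * ?L"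
      using L by linarith+
    show "?L / 2 * norm z ^ degree F \<le> norm (poly F z)"
      unfolding eq[symmetric] by (rule mult_right_mono[OF *(1)]) simp
    show "norm (poly F z) \<le> 2 * ?L * norm z ^ degree F"
      unfolding eq[symmetric] by (rule mult_right_mono[OF *(2)]) simp
  qed
qed

text \<open>The slope 4 is the quotient of the growth constants 2 and 1/2; the constant term absorbs
  the cases in which \<open>x\<close> or \<open>y\<close> lies in the disc of radius
  \<open>R\<close>. The bound keeps a product over a block class of polynomial growth.\<close>

lemma fibre_linear_growth:
  fixes F :: "complex poly"
  assumes "degree F > 0"
  obtains C where "C \<ge> 0" "\<And>x y. poly F x = poly F y \<Longrightarrow> norm y \<le> C + 4 * norm x"
proof -
  let ?L = "norm (lead_coeff F)" and ?N = "degree F"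
  have L: "?L > 0"
    using assms by auto
  obtain R where R: "R > 0"
    "\<And>z. norm z > R \<Longrightarrow> ?L / 2 * norm z ^ ?N \<le> norm (poly F z)"
    "\<And>z. norm z > R \<Longrightarrow> norm (poly F z) \<le> 2 * ?L * norm z ^ ?N"
    using poly_growth[OF assms] by blast
  have "compact (poly F ` cball 0 R)"
    by (intro compact_continuous_image continuous_intros) auto
  then obtain A where "\<forall>w\<in>poly F ` cball 0 R. norm w \<le> A"
    using compact_imp_bounded bounded_iff by blast
  then have A: "\<And>x. norm x \<le> R \<Longrightarrow> norm (poly F x) \<le> A"
    by simp
  have "A \<ge> 0"
    using order_trans[OF norm_ge_zero A[of 0]] R(1) by simp
  show ?thesis
  proof
    show "R + 2 * A / ?L + 1 \<ge> 0"
      using \<open>A \<ge> 0\<close> R(1) by simp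
    fix x y assume eq: "poly F x = poly F y"
    consider "norm y \<le> R" | "norm y > R" "norm x \<le> R" | "norm y > R" "norm x > R"
      by linarith
    then show "norm y \<le> R + 2 * A / ?L + 1 + 4 * norm x"
    proof cases
      case 1
      then show ?thesis
        using \<open>A \<ge> 0\<close> by (simp add: add_increasing2)
    next
      case 2
      then have "?L / 2 * norm y ^ ?N \<le> A"
        using R(2)[of y] A[of x] eq by simp
      then have *: "norm y ^ ?N \<le> 2 * A / ?L"
        using L by (simp add: field_simps)
      have "norm y \<le> 1 + norm y ^ ?N"
      proof (cases "norm y \<le> 1")
        case False
        then show ?thesis
          using self_le_power[of "norm y" ?N] assms by simp
      qed (simp add: add_increasing2)
      then show ?thesis
        using * R(1) by (smt (verit) norm_ge_zero)
    next
      case 3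
      have "?L / 2 * norm y ^ ?N \<le> 2 * ?L * norm x ^ ?N"
        using R(2)[OF 3(1)] R(3)[OF 3(2)] eq by simp
      then have "norm y ^ ?N \<le> 4 * norm x ^ ?N"
        using L by (simp add: field_simps)
      also have "\<dots> \<le> 4 ^ ?N * norm x ^ ?N"
        using self_le_power[of "4::real" ?N] assms by (intro mult_right_mono) auto
      also have "\<dots> = (4 * norm x) ^ ?N"
        by (simp add: power_mult_distrib)
      finally have "norm y \<le> 4 * norm x"
        using assms by (subst (asm) power_mono_iff) auto
      then show ?thesis
        using R(1) \<open>A \<ge> 0\<close> by (simp add: add_increasing)
    qed
  qed
qed

section \<open>The block carried to every regular fibre\<close>

text \<open>The class of \<open>x\<close> consists of the points that move into \<open>B\<close>
  together with \<open>x\<close>. One path suffices in the definition because the outcome does not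
  depend on the path, as \<open>block_class_iff\<close> shows.\<close>

definition block_class :: "complex poly \<Rightarrow> complex \<Rightarrow> complex set \<Rightarrow> complex \<Rightarrow> complex set" where
  "block_class F p B x = {y. \<exists>\<gamma> b c. regular_path F \<gamma> (poly F x) p \<and>
     transports F \<gamma> x b \<and> transports F \<gamma> y c \<and> b \<in> B \<and> c \<in> B}"

context
  fixes F :: "complex poly" and p a :: complex and B :: "complex set"
  assumes deg: "degree F > 0" and p: "p \<notin> critical_values F"
    and block: "is_block (monodromy_group F p) {x. poly F x = p} B" and a: "a \<in> B"
begin

private abbreviation "cls \<equiv> block_class F p B"
private abbreviation "sing \<equiv> {x. poly F x \<in> critical_values F}"

lemma block_fibre: "b \<in> B \<Longrightarrow> poly F b = p"
  using block by (auto simp: is_block_def)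

lemma finite_block: "finite B"
  using block finite_fibre[OF deg, of p] by (auto simp: is_block_def intro: finite_subset)

lemma finite_sing: "finite sing"
  by (rule finite_critical_fibres[OF deg])

lemma block_class_fibre: "y \<in> cls x \<Longrightarrow> poly F y = poly F x"
  by (auto simp: block_class_def dest: transports_fibre(1))

text \<open>Two paths to \<open>p\<close> that take \<open>x\<close> into \<open>B\<close> differ by
  a loop at \<open>p\<close> sending a point of \<open>B\<close> to a point of \<open>B\<close>, and
  such a loop preserves \<open>B\<close>.\<close>

lemma block_class_iff:
  assumes \<gamma>: "regular_path F \<gamma> (poly F x) p" "transports F \<gamma> x b" "b \<in> B" "transports F \<gamma> y c"
  shows "y \<in> cls x \<longleftrightarrow> c \<in> B"
proof
  assume "y \<in> cls x"
  then obtain \<delta> b' c' where \<delta>: "regular_path F \<delta> (poly F x) p" "transports F \<delta> x b'"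
      "transports F \<delta> y c'" "b' \<in> B" "c' \<in> B"
    by (auto simp: block_class_def)
  have "transports F (reversepath \<delta> +++ \<gamma>) b' b" "transports F (reversepath \<delta> +++ \<gamma>) c' c"
    using \<gamma> \<delta> by (blast intro: transports_join transports_reverse)+
  then show "c \<in> B"
    using block_transports_iff[OF deg block
        regular_path_join[OF regular_path_reverse[OF \<delta>(1)] \<gamma>(1)]] \<gamma>(3) \<delta>(4,5) by blast
qed (use assms in \<open>auto simp: block_class_def\<close>)

lemma path_to_block:
  assumes "x \<notin> sing"
  obtains \<gamma> where "regular_path F \<gamma> (poly F x) p" "transports F \<gamma> x a"
  using transports_transitive[OF deg _ refl p block_fibre[OF a], of x] assms by auto

lemma block_class_refl: "x \<notin> sing \<Longrightarrow> x \<in> cls x"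
  using path_to_block a block_class_iff by metis

lemma block_class_eq:
  assumes "x \<notin> sing" "y \<in> cls x"
  shows "cls y = cls x"
proof -
  obtain \<gamma> where \<gamma>: "regular_path F \<gamma> (poly F x) p" "transports F \<gamma> x a"
    using path_to_block[OF assms(1)] .
  have eq: "poly F y = poly F x"
    using block_class_fibre[OF assms(2)] .
  obtain c where c: "transports F \<gamma> y c"
    using transports_exists[OF deg \<gamma>(1) eq] .
  have "c \<in> B"
    using block_class_iff[OF \<gamma> a c] assms(2) by simp
  have "z \<in> cls y \<longleftrightarrow> z \<in> cls x" for z
  proof (cases "poly F z = poly F x")
    case True
    then obtain d where d: "transports F \<gamma> z d"
      using transports_exists[OF deg \<gamma>(1)] by blast
    show ?thesis
      using block_class_iff[OF \<gamma> a d] block_class_iff[OF _ c \<open>c \<in> B\<close> d] \<gamma>(1) eq by simp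
  qed (use eq block_class_fibre in metis)
  then show ?thesis by blast
qed

lemma card_block_class:
  assumes "x \<notin> sing"
  shows "card (cls x) = card B" "finite (cls x)"
proof -
  obtain \<gamma> where \<gamma>: "regular_path F \<gamma> (poly F x) p" "transports F \<gamma> x a"
    using path_to_block[OF assms] .
  obtain \<phi> where \<phi>: "bij_betw \<phi> {y. poly F y = poly F x} {y. poly F y = p}"
      "\<And>y. poly F y = poly F x \<Longrightarrow> transports F \<gamma> y (\<phi> y)"
    using transport_map[OF deg \<gamma>(1)] by blast
  have sub: "cls x \<subseteq> {y. poly F y = poly F x}"
    using block_class_fibre by blast
  have mem: "y \<in> cls x \<longleftrightarrow> \<phi> y \<in> B" if "poly F y = poly F x" for y
    using block_class_iff[OF \<gamma> a \<phi>(2)[OF that]] .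
  have "\<phi> ` cls x = B"
  proof (intro equalityI subsetI)
    fix b assume b: "b \<in> B"
    then have "b \<in> \<phi> ` {y. poly F y = poly F x}"
      using bij_betw_imp_surj_on[OF \<phi>(1)] block_fibre by simp
    then show "b \<in> \<phi> ` cls x"
      using mem b by blast
  qed (use mem sub in blast)
  then have "bij_betw \<phi> (cls x) B"
    using bij_betw_subset[OF \<phi>(1) sub] by blast
  then show "card (cls x) = card B"
    by (rule bij_betw_same_card)
  show "finite (cls x)"
    using sub finite_fibre[OF deg] finite_subset by blast
qed

text \<open>A path from \<open>x'\<close> into the block, preceded by \<open>\<delta>\<close>, is a
  path from \<open>x\<close> into the block, so both classes are tested by the same end points over
  \<open>p\<close>.\<close>

lemma block_class_transports:
  assumes "x \<notin> sing" "regular_path F \<delta> (poly F x) q" "transports F \<delta> x x'" "y \<in> cls x" "transports F \<delta> y y'"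
  shows "y' \<in> cls x'"
proof -
  have x': "poly F x' = q" "q \<notin> critical_values F"
    using transports_fibre[OF assms(2,3)] assms(2) pathfinish_in_path_image[of \<delta>]
    by (auto simp: regular_path_def)
  then obtain \<gamma> where \<gamma>: "regular_path F \<gamma> (poly F x') p" "transports F \<gamma> x' a"
    using path_to_block[of x'] by auto
  have "poly F y' = poly F x'"
    using transports_fibre[OF assms(2,5)] x' by simp
  then obtain c where c: "transports F \<gamma> y' c"
    using transports_exists[OF deg \<gamma>(1)] by blast
  have "regular_path F (\<delta> +++ \<gamma>) (poly F x) p"
    using regular_path_join[OF assms(2)] \<gamma>(1) x'(1) by simp
  then have "c \<in> B"
    using block_class_iff[of "\<delta> +++ \<gamma>" x a y c] transports_join[OF assms(3) \<gamma>(2)]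
      transports_join[OF assms(5) c] a assms(4) by blast
  then show ?thesis
    using block_class_iff[OF \<gamma> a c] by simp
qed

lemma block_class_base:
  assumes "b \<in> B"
  shows "cls b = B"
proof -
  have triv: "transports F (linepath p p) y y" if "poly F y = p" for y
    unfolding transports_def is_lift_def using that
    by (intro exI[of _ "linepath y y"] conjI path_linepath pathstart_linepath pathfinish_linepath)
      (simp add: linepath_refl)
  have reg: "regular_path F (linepath p p) (poly F b) p"
    using p block_fibre[OF assms] by (simp add: regular_path_def)
  have "y \<in> cls b \<longleftrightarrow> y \<in> B" for y
  proof (cases "poly F y = p")
    case True
    then show ?thesis
      using block_class_iff[OF reg triv[OF block_fibre[OF assms]] assms triv] by blast
  next
    case False
    then show ?thesis
      using block_class_fibre[of y b] block_fibre assms by auto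
  qed
  then show ?thesis by blast
qed

text \<open>
  This function is constant on block classes and vanishes exactly on \<open>B\<close>, so once it is known to be
  a polynomial of degree at most \<open>card B\<close>, it is a multiple of the product of the linear factors
  at the points of \<open>B\<close>.
\<close>

definition "block_fun x = (\<Prod>y\<in>cls x. a - y)"

text \<open>Near \<open>x0\<close> the class of \<open>x\<close> consists of the values at
  \<open>poly F x\<close> of the local sections of \<open>F\<close> through the points of
  \<open>cls x0\<close>, so \<open>block_fun\<close> is locally a finite product of holomorphic
  functions.\<close>

lemma block_fun_holomorphic: "block_fun holomorphic_on - sing"
proof -
  have "\<exists>g U. open U \<and> x0 \<in> U \<and> g holomorphic_on U \<and> (\<forall>x\<in>U. g x = block_fun x)"
    if x0: "x0 \<notin> sing" for x0
  proof -
    define w0 where "w0 = poly F x0"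
    have w0: "w0 \<notin> critical_values F"
      using x0 by (simp add: w0_def)
    obtain r \<eta> where r: "r > 0" "ball w0 r \<inter> critical_values F = {}"
      and \<eta>0: "\<And>z. poly F z = w0 \<Longrightarrow> \<eta> z w0 = z"
      and hol: "\<And>z. poly F z = w0 \<Longrightarrow> \<eta> z holomorphic_on ball w0 r"
      and sec: "\<And>z w. poly F z = w0 \<Longrightarrow> w \<in> ball w0 r \<Longrightarrow> poly F (\<eta> z w) = w"
      and bij: "\<And>w. w \<in> ball w0 r \<Longrightarrow> bij_betw (\<lambda>z. \<eta> z w) {z. poly F z = w0} {z. poly F z = w}"
      using regular_local_sections[OF deg w0] by blast
    define U where "U = \<eta> x0 ` ball w0 r"
    have x0w: "poly F x0 = w0"
      by (simp add: w0_def)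
    have "inj_on (\<eta> x0) (ball w0 r)"
      using sec[OF x0w] by (metis inj_onI)
    then have "open U"
      unfolding U_def using open_mapping_thm3[OF hol[OF x0w]] by simp
    have "x0 \<in> U"
      unfolding U_def using \<eta>0[OF x0w] r(1) by (metis centre_in_ball imageI)
    have fib: "poly F y = w0" if "y \<in> cls x0" for y
      using block_class_fibre[OF that] x0w by simp
    have FU: "poly F x \<in> ball w0 r" "x = \<eta> x0 (poly F x)" if "x \<in> U" for x
      using that sec[OF x0w] by (auto simp: U_def)
    have cls_eq: "cls x = (\<lambda>y. \<eta> y (poly F x)) ` cls x0"
      and inj: "inj_on (\<lambda>y. \<eta> y (poly F x)) (cls x0)" if x: "x \<in> U" for x
    proof -
      define w where "w = poly F x"
      have w: "w \<in> ball w0 r"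
        using FU[OF x] by (simp add: w_def)
      \<comment> \<open>Over the segment from \<open>w0\<close> to \<open>w\<close> the lifts are
        given by the local sections, so transport takes \<open>y\<close> to
        \<open>\<eta> y w\<close>.\<close>
      have seg: "closed_segment w0 w \<subseteq> ball w0 r"
        using w r(1) by (intro closed_segment_subset) auto
      have reg: "regular_path F (linepath w0 w) w0 w"
        using seg r(2) by (auto simp: regular_path_def)
      have tr: "transports F (linepath w0 w) y (\<eta> y w)" if y: "poly F y = w0" for y
      proof -
        have "path (\<eta> y \<circ> linepath w0 w)"
          using seg holomorphic_on_imp_continuous_on[OF hol[OF y]]
          by (intro path_continuous_image) (auto intro: continuous_on_subset)
        moreover have "poly F (\<eta> y (linepath w0 w t)) = linepath w0 w t" if "t \<in> {0..1}" for t
          using sec[OF y] seg that linepath_in_path by blast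
        ultimately show ?thesis
          unfolding transports_def is_lift_def
          by (intro exI[of _ "\<eta> y \<circ> linepath w0 w"])
            (auto simp: pathstart_compose pathfinish_compose \<eta>0[OF y])
      qed
      have "\<eta> x0 w = x"
        using FU(2)[OF x] by (simp add: w_def)
      then have sub: "(\<lambda>y. \<eta> y w) ` cls x0 \<subseteq> cls x"
        using block_class_transports[OF x0, of "linepath w0 w" w] reg tr fib x0w by fastforce
      show inj: "inj_on (\<lambda>y. \<eta> y (poly F x)) (cls x0)"
        using bij_betw_imp_inj_on[OF bij[OF w]] unfolding w_def
        by (rule inj_on_subset) (use fib in auto)
      have xs: "x \<notin> sing"
        using w r(2) by (auto simp: w_def)
      \<comment> \<open>The inclusion \<open>sub\<close> is an equality because all classes have
        \<open>card B\<close> points.\<close>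
      show "cls x = (\<lambda>y. \<eta> y (poly F x)) ` cls x0"
        using card_subset_eq[OF card_block_class(2)[OF xs] sub] card_block_class(1)[OF xs]
          card_block_class(1)[OF x0] card_image[OF inj] by (simp add: w_def)
    qed
    have "(\<lambda>x. \<Prod>y\<in>cls x0. a - \<eta> y (poly F x)) holomorphic_on U"
    proof (intro holomorphic_intros)
      fix y assume y: "y \<in> cls x0"
      have "\<eta> y \<circ> poly F holomorphic_on U"
      proof (rule holomorphic_on_compose_gen)
        show "poly F holomorphic_on U"
          using poly_holomorphic_on[OF holomorphic_on_ident] by simp
        show "\<eta> y holomorphic_on ball w0 r"
          using hol fib y by blast
        show "poly F ` U \<subseteq> ball w0 r"
          using FU by blast
      qed
      then show "(\<lambda>x. \<eta> y (poly F x)) holomorphic_on U"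
        by (simp add: o_def)
    qed
    moreover have "(\<Prod>y\<in>cls x0. a - \<eta> y (poly F x)) = block_fun x" if "x \<in> U" for x
      unfolding block_fun_def cls_eq[OF that] by (simp add: prod.reindex[OF inj[OF that]])
    ultimately show ?thesis
      using \<open>open U\<close> \<open>x0 \<in> U\<close> by blast
  qed
  note local = this
  have "open (- sing)"
    using finite_sing by (simp add: finite_imp_closed open_Compl)
  show ?thesis
    unfolding holomorphic_on_def
  proof
    fix x0 assume "x0 \<in> - sing"
    then obtain g U where U: "open U" "x0 \<in> U" "g holomorphic_on U" "\<forall>x\<in>U. g x = block_fun x"
      using local by blast
    then have "g field_differentiable at x0"
      by (simp add: holomorphic_on_imp_differentiable_at)
    then have "block_fun field_differentiable at x0"
      unfolding field_differentiable_def
      using has_field_derivative_transform_within_open[OF _ U(1,2), of g _ block_fun] U(4) by blast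
    then show "block_fun field_differentiable at x0 within - sing"
      by (rule field_differentiable_at_within)
  qed
qed

lemma block_fun_bound:
  obtains C where "C \<ge> 0" "\<And>x. x \<notin> sing \<Longrightarrow> norm (block_fun x) \<le> (C + 4 * norm x) ^ card B"
proof -
  obtain C where C: "C \<ge> 0" "\<And>x y. poly F x = poly F y \<Longrightarrow> norm y \<le> C + 4 * norm x"
    using fibre_linear_growth[OF deg] by blast
  show ?thesis
  proof
    show "norm a + C \<ge> 0"
      using C(1) by simp
    fix x assume x: "x \<notin> sing"
    have "norm (block_fun x) = (\<Prod>y\<in>cls x. norm (a - y))"
      by (simp add: block_fun_def prod_norm)
    also have "\<dots> \<le> (\<Prod>y\<in>cls x. norm a + C + 4 * norm x)"
    proof (intro prod_mono conjI)
      fix y assume "y \<in> cls x"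
      then have "norm y \<le> C + 4 * norm x"
        using C(2) block_class_fibre by metis
      then show "norm (a - y) \<le> norm a + C + 4 * norm x"
        using norm_triangle_ineq4[of a y] by linarith
    qed simp
    also have "\<dots> = (norm a + C + 4 * norm x) ^ card B"
      using card_block_class[OF x] by simp
    finally show "norm (block_fun x) \<le> (norm a + C + 4 * norm x) ^ card B" .
  qed
qed

text \<open>Multiplied by the product \<open>D\<close> of the linear factors at the singular points,
  \<open>block_fun\<close> extends by 0 to an entire function of polynomial growth. By Liouville it
  is a polynomial of degree at most \<open>card B + card sing\<close>, and dividing by
  \<open>D\<close> restores the bound \<open>card B\<close>.\<close>

lemma block_fun_poly:
  obtains H where "degree H \<le> card B" "\<And>x. x \<notin> sing \<Longrightarrow> poly H x = block_fun x"
proof -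
  obtain C where C: "C \<ge> 0" "\<And>x. x \<notin> sing \<Longrightarrow> norm (block_fun x) \<le> (C + 4 * norm x) ^ card B"
    using block_fun_bound by blast
  define D where "D = (\<Prod>k\<in>sing. [:-k, 1:])"
  have D: "poly D x = (\<Prod>k\<in>sing. x - k)" for x
    by (simp add: D_def poly_prod)
  have D0: "poly D x = 0 \<longleftrightarrow> x \<in> sing" for x
    unfolding D using finite_sing by auto
  \<comment> \<open>The value 0 on \<open>sing\<close> is the limit there: \<open>W\<close> is
    dominated by \<open>M\<close>, which is continuous and vanishes on \<open>sing\<close>.\<close>
  define W where "W x = (if x \<in> sing then 0 else block_fun x * poly D x)" for x
  define M where "M x = (C + 4 * norm x) ^ card B * norm (poly D x)" for x
  have WM: "norm (W x) \<le> M x" for x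
    using C by (auto simp: W_def M_def norm_mult intro!: mult_right_mono)
  have "W holomorphic_on UNIV"
  proof (rule no_isolated_singularity'[OF _ _ open_UNIV finite_sing])
    have "(\<lambda>x. block_fun x * poly D x) holomorphic_on - sing"
      using poly_holomorphic_on[OF holomorphic_on_ident]
      by (intro holomorphic_intros block_fun_holomorphic)
    then have "W holomorphic_on - sing"
      by (rule holomorphic_transform) (simp add: W_def)
    then show "W holomorphic_on UNIV - sing"
      by (simp only: Compl_eq_Diff_UNIV)
    fix z assume z: "z \<in> sing"
    have "isCont M z"
      unfolding M_def by (intro continuous_intros)
    moreover have "M z = 0"
      using z D0 by (simp add: M_def)
    ultimately have "(M \<longlongrightarrow> 0) (at z)"
      by (simp add: isCont_def)
    then have "(W \<longlongrightarrow> 0) (at z)"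
      by (rule Lim_null_comparison[rotated]) (simp add: WM)
    then show "(W \<longlongrightarrow> W z) (at z within UNIV)"
      using z by (simp add: W_def)
  qed
  moreover have "norm (W x) \<le> (C + 4) ^ card B * (\<Prod>k\<in>sing. 1 + norm k) * norm x ^ (card B + card sing)"
    if x: "1 \<le> norm x" for x
  proof -
    have "C + 4 * norm x \<le> (C + 4) * norm x"
      using C(1) x mult_left_mono[of 1 "norm x" C] by (simp add: algebra_simps)
    then have 1: "(C + 4 * norm x) ^ card B \<le> ((C + 4) * norm x) ^ card B"
      using C(1) by (intro power_mono) auto
    have "norm (poly D x) = (\<Prod>k\<in>sing. norm (x - k))"
      by (simp only: D prod_norm)
    also have "\<dots> \<le> (\<Prod>k\<in>sing. (1 + norm k) * norm x)"
    proof (intro prod_mono conjI)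
      fix k :: complex
      have "norm k * 1 \<le> norm k * norm x"
        using x by (intro mult_left_mono) auto
      then show "norm (x - k) \<le> (1 + norm k) * norm x"
        using norm_triangle_ineq4[of x k] by (simp add: algebra_simps)
    qed simp
    also have "\<dots> = (\<Prod>k\<in>sing. 1 + norm k) * norm x ^ card sing"
      by (simp add: prod.distrib)
    finally have 2: "norm (poly D x) \<le> (\<Prod>k\<in>sing. 1 + norm k) * norm x ^ card sing" .
    have "norm (W x) \<le> M x"
      by (rule WM)
    also have "\<dots> \<le> ((C + 4) * norm x) ^ card B * ((\<Prod>k\<in>sing. 1 + norm k) * norm x ^ card sing)"
      unfolding M_def using 1 2 C(1) by (intro mult_mono) auto
    finally show ?thesis
      by (simp only: power_mult_distrib power_add mult.assoc mult.commute mult.left_commute)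
  qed
  ultimately have W: "W x = (\<Sum>k\<le>card B + card sing. (deriv ^^ k) W 0 / fact k * x ^ k)" for x
    by (rule Liouville_polynomial)
  define P where "P = (\<Sum>k\<le>card B + card sing. monom ((deriv ^^ k) W 0 / fact k) k)"
  have P: "poly P x = W x" for x
    unfolding W[of x] by (simp add: P_def poly_sum poly_monom)
  have degP: "degree P \<le> card B + card sing"
    unfolding P_def by (intro degree_sum_le) (auto intro: order_trans[OF degree_monom_le])
  have "D dvd P"
    unfolding D_def by (rule prod_linear_dvd[OF finite_sing]) (simp add: P W_def)
  then obtain H where H: "P = D * H" ..
  show ?thesis
  proof
    have "degree D = card sing"
      by (simp add: D_def degree_prod_linear)
    moreover have "D \<noteq> 0"
      using finite_sing by (simp add: D_def)
    ultimately show "degree H \<le> card B"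
      using degP by (cases "H = 0") (auto simp: H degree_mult_eq)
    show "poly H x = block_fun x" if "x \<notin> sing" for x
      using P[of x] that D0[of x] by (simp add: H W_def)
  qed
qed

text \<open>\<open>H\<close> has degree at most \<open>card B\<close> and vanishes on
  \<open>B\<close>, so it is a constant multiple of \<open>v\<close>. Hence \<open>v\<close> is
  constant on the block classes; by counting, its fibres through regular points are the classes. On
  these \<open>F\<close> is constant, so \<open>F\<close> is a polynomial in
  \<open>v\<close>.\<close>

lemma block_decomposition:
  obtains u where "F = pcompose u (\<Prod>b\<in>B. [:-b, 1:])"
proof -
  define v where "v = (\<Prod>b\<in>B. [:-b, 1:])"
  have deg_v: "degree v = card B"
    by (simp add: v_def degree_prod_linear)
  then have deg_v_pos: "degree v > 0"
    using a finite_block by (simp add: card_gt_0_iff) blast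
  obtain H where H: "degree H \<le> card B" "\<And>x. x \<notin> sing \<Longrightarrow> poly H x = block_fun x"
    using block_fun_poly by blast
  have B_regular: "b \<notin> sing" if "b \<in> B" for b
    using p block_fibre[OF that] by simp
  have "poly H b = 0" if b: "b \<in> B" for b
    using H(2)[OF B_regular[OF b]] finite_block a by (simp add: block_fun_def block_class_base[OF b])
  then have "v dvd H"
    unfolding v_def by (intro prod_linear_dvd[OF finite_block])
  then obtain c where c: "H = v * c" ..
  \<comment> \<open>A point \<open>x1\<close> outside \<open>sing\<close> and \<open>B\<close> has a
    class not containing \<open>a\<close>, so \<open>block_fun x1\<close> is nonzero. This excludes
    \<open>H = 0\<close>.\<close>
  have "finite (sing \<union> B)"
    using finite_sing finite_block by simp
  then obtain x1 where x1: "x1 \<notin> sing" "x1 \<notin> B"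
    using ex_new_if_finite[OF infinite_UNIV_char_0] by blast
  have "a \<notin> cls x1"
    using block_class_eq[OF x1(1), of a] block_class_base[OF a] block_class_refl[OF x1(1)] x1(2) by auto
  then have "block_fun x1 \<noteq> 0"
    using card_block_class(2)[OF x1(1)] by (auto simp: block_fun_def)
  then have "H \<noteq> 0"
    using H(2)[OF x1(1)] by auto
  then have nz: "v \<noteq> 0" "c \<noteq> 0"
    using c by auto
  then have "degree c = 0"
    using H(1) deg_v by (simp add: c degree_mult_eq)
  then obtain \<kappa> where \<kappa>: "c = [:\<kappa>:]"
    by (rule degree_eq_zeroE)
  have \<kappa>0: "\<kappa> \<noteq> 0"
    using nz \<kappa> by auto
  have v_const: "poly v y = poly v x" if "x \<notin> sing" "y \<in> cls x" for x y
  proof -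
    have "y \<notin> sing"
      using that block_class_fibre[OF that(2)] by simp
    then have "poly H y = poly H x"
      using H(2) that block_class_eq[OF that] by (simp add: block_fun_def)
    then show ?thesis
      using \<kappa>0 by (simp add: c \<kappa>)
  qed
  have v_fibre: "{z. poly v z = poly v x} = cls x" if x: "x \<notin> sing" for x
  proof (rule card_seteq[symmetric])
    show "finite {z. poly v z = poly v x}"
      by (rule finite_fibre[OF deg_v_pos])
    show "cls x \<subseteq> {z. poly v z = poly v x}"
      using v_const[OF x] by blast
    show "card {z. poly v z = poly v x} \<le> card (cls x)"
      using card_fibre_le[OF deg_v_pos] card_block_class(1)[OF x] deg_v by simp
  qed
  let ?T = "{t. card {z. poly v z = t} = degree v \<and>
                (\<forall>x y. poly v x = t \<longrightarrow> poly v y = t \<longrightarrow> poly F x = poly F y)}"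
  have "- (poly v ` sing) \<subseteq> ?T"
  proof
    fix t assume t: "t \<in> - (poly v ` sing)"
    obtain x where x: "poly v x = t"
      using poly_surj_complex[OF deg_v_pos] .
    then have "x \<notin> sing"
      using t by blast
    then have fib: "{z. poly v z = t} = cls x"
      using v_fibre[OF \<open>x \<notin> sing\<close>] x by simp
    have "card {z. poly v z = t} = degree v"
      unfolding fib using card_block_class(1)[OF \<open>x \<notin> sing\<close>] deg_v by simp
    moreover have "poly F y = poly F x" if "poly v y = t" for y
      using fib that block_class_fibre[of y x] by auto
    then have "\<forall>x y. poly v x = t \<longrightarrow> poly v y = t \<longrightarrow> poly F x = poly F y"
      by simp
    ultimately show "t \<in> ?T"
      by (intro CollectI conjI)
  qed
  moreover have "infinite (- (poly v ` sing))"
    using finite_sing by (simp add: Compl_eq_Diff_UNIV infinite_UNIV_char_0)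
  ultimately have "infinite ?T"
    using infinite_super by blast
  then obtain u where "F = pcompose u v"
    using pcompose_if_constant_on_fibres[OF deg_v_pos] by blast
  with that show ?thesis
    by (simp add: v_def)
qed

end

subsection \<open>Fibres near infinity\<close>

text \<open>In the coordinate \<open>t = inverse z\<close> the polynomial is \<open>z ^ N\<close>
  times the reversed polynomial, which has a holomorphic \<open>N\<close>-th root
  \<open>\<psi>\<close> near 0; this gives \<open>X z = z * \<psi> (inverse z)\<close>. The
  reciprocal of \<open>X\<close> is \<open>Y t = t / \<psi> t\<close>, whose derivative at 0 is
  nonzero, so \<open>X\<close> is injective for large \<open>z\<close>.\<close>

lemma uniformizer_at_infinity:
  fixes P :: "complex poly"
  assumes "degree P > 0"
  obtains R X where "R > 0" "\<And>z. norm z > R \<Longrightarrow> X z ^ degree P = poly P z"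
    "inj_on X {z. norm z > R}" "continuous_on {z. norm z > R} X"
proof -
  define N where "N = degree P"
  define L where "L = lead_coeff P"
  have N: "N > 0" and L: "L \<noteq> 0"
    using assms by (auto simp: N_def L_def)
  let ?Q = "reflect_poly P"
  \<comment> \<open>Splitting off an \<open>N\<close>-th root \<open>l\<close> of the leading
    coefficient leaves a quotient near 1, where the principal logarithm is holomorphic.\<close>
  have "degree (monom (1::complex) N) > 0"
    using N by (simp add: degree_monom_eq)
  then obtain l where "poly (monom 1 N) l = L"
    using poly_surj_complex by blast
  then have l: "l ^ N = L" "l \<noteq> 0"
    using L N by (auto simp: poly_monom)
  have "isCont (\<lambda>t. poly ?Q t / L) 0"
    using L by (intro continuous_intros) auto
  moreover have "poly ?Q 0 / L = 1"
    using L by (simp add: L_def)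
  ultimately have "\<forall>e>0. \<exists>d>0. \<forall>t. norm t < d \<longrightarrow> norm (poly ?Q t / L - 1) < e"
    unfolding continuous_at_eps_delta by (simp add: dist_norm)
  then obtain d where d: "d > 0" "\<And>t. norm t < d \<Longrightarrow> norm (poly ?Q t / L - 1) < 1"
    using zero_less_one by blast
  have Re: "Re (poly ?Q t / L) > 0" if "norm t < d" for t
    using d(2)[OF that] abs_Re_le_cmod[of "poly ?Q t / L - 1"] by simp
  define \<psi> where "\<psi> t = l * exp (Ln (poly ?Q t / L) / of_nat N)" for t
  have \<psi>_pow: "\<psi> t ^ N = poly ?Q t" if "norm t < d" for t
  proof -
    have "poly ?Q t / L \<noteq> 0"
      using Re[OF that] by auto
    then have "\<psi> t ^ N = L * (poly ?Q t / L)"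
      using N by (simp add: \<psi>_def power_mult_distrib l(1) exp_of_nat_mult[symmetric])
    then show ?thesis
      using L by simp
  qed
  have \<psi>0: "\<psi> t \<noteq> 0" for t
    using l(2) by (simp add: \<psi>_def)
  have "(\<lambda>t. poly ?Q t / L) holomorphic_on ball 0 d"
    using L by (intro holomorphic_intros)
  moreover have "poly ?Q t / L \<notin> \<real>\<^sub>\<le>\<^sub>0" if "t \<in> ball 0 d" for t
    using Re[of t] that by (auto simp: complex_nonpos_Reals_iff)
  ultimately have \<psi>_hol: "\<psi> holomorphic_on ball 0 d"
    unfolding \<psi>_def using N by (intro holomorphic_intros) auto
  define Y where "Y t = t / \<psi> t" for t
  have Y_hol: "Y holomorphic_on ball 0 d"
    unfolding Y_def using \<psi>_hol \<psi>0 by (intro holomorphic_intros)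
  have "(\<psi> has_field_derivative deriv \<psi> 0) (at 0)"
    using \<psi>_hol d(1) by (intro holomorphic_derivI[of \<psi> "ball 0 d"]) auto
  then have "(Y has_field_derivative (1 * \<psi> 0 - 0 * deriv \<psi> 0) / (\<psi> 0 * \<psi> 0)) (at 0)"
    unfolding Y_def using \<psi>0 by (intro derivative_intros)
  then have "deriv Y 0 = \<psi> 0 / (\<psi> 0 * \<psi> 0)"
    by (simp add: DERIV_imp_deriv)
  then have Y': "deriv Y 0 \<noteq> 0"
    using \<psi>0 by simp
  have "(0::complex) \<in> ball 0 d"
    using d(1) by simp
  then obtain r where r: "r > 0" "ball (0::complex) r \<subseteq> ball 0 d" "inj_on Y (ball 0 r)"
    using has_complex_derivative_locally_injective[OF Y_hol _ open_ball Y'] by blast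
  have inv: "inverse z \<in> ball 0 r" "z \<noteq> 0" if "norm z > 1 / r" for z :: complex
  proof -
    have "norm z > 0"
      using that r(1) by (meson order.strict_trans zero_less_divide_1_iff)
    then show "inverse z \<in> ball 0 r" "z \<noteq> 0"
      using that r(1) by (auto simp: norm_divide field_simps)
  qed
  define X where "X z = z * \<psi> (inverse z)" for z
  show ?thesis
  proof
    show "1 / r > 0"
      using r(1) by simp
    show "X z ^ degree P = poly P z" if "norm z > 1 / r" for z
    proof -
      have "norm (inverse z) < d"
        using inv(1)[OF that] r(2) by (auto simp: subset_iff)
      then have "X z ^ N = z ^ N * poly ?Q (inverse z)"
        by (simp add: X_def power_mult_distrib \<psi>_pow)
      also have "\<dots> = poly P z"
        using inv(2)[OF that] by (simp add: poly_reflect_poly_nz N_def field_simps)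
      finally show ?thesis
        by (simp add: N_def)
    qed
    show "inj_on X {z. norm z > 1 / r}"
    proof (rule inj_onI)
      fix z w assume zw: "z \<in> {z. norm z > 1 / r}" "w \<in> {z. norm z > 1 / r}" "X z = X w"
      have "Y (inverse z) = inverse (X z)" "Y (inverse w) = inverse (X w)"
        by (simp_all add: Y_def X_def field_simps)
      then have "Y (inverse z) = Y (inverse w)"
        using zw by simp
      then have "inverse z = inverse w"
        using r(3) inv(1) zw(1,2) by (auto dest: inj_onD)
      then show "z = w"
        by simp
    qed
    have "continuous_on (ball 0 d) \<psi>"
      using \<psi>_hol by (rule holomorphic_on_imp_continuous_on)
    moreover have "inverse ` {z::complex. norm z > 1 / r} \<subseteq> ball 0 d"
      using inv(1) r(2) by blast
    moreover have "continuous_on {z. norm z > 1 / r} (inverse :: complex \<Rightarrow> complex)"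
      using inv(2) by (intro continuous_intros) auto
    ultimately have "continuous_on {z. norm z > 1 / r} (\<lambda>z. \<psi> (inverse z))"
      using continuous_on_compose2 by blast
    then show "continuous_on {z. norm z > 1 / r} X"
      unfolding X_def by (intro continuous_intros)
  qed
qed

lemma poly_large_at_infinity:
  fixes P :: "complex poly"
  assumes "degree P > 0"
  obtains R where "\<And>z. norm z > R \<Longrightarrow> norm (poly P z) > A"
proof -
  obtain R where R: "R > 0"
    "\<And>z. norm z > R \<Longrightarrow> norm (lead_coeff P) / 2 * norm z ^ degree P \<le> norm (poly P z)"
    using poly_growth[OF assms] by metis
  let ?L = "norm (lead_coeff P) / 2"
  have L: "?L > 0"
    using assms by auto
  show ?thesis
  proof
    fix z :: complex assume z: "norm z > max (max R 1) (A / ?L)"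
    have "A < ?L * norm z"
      using z L by (simp add: field_simps)
    also have "\<dots> \<le> ?L * norm z ^ degree P"
      using z L assms self_le_power[of "norm z" "degree P"] by (intro mult_left_mono) auto
    also have "\<dots> \<le> norm (poly P z)"
      using z by (intro R(2)) auto
    finally show "norm (poly P z) > A" .
  qed
qed

text \<open>With \<open>U\<close> the coordinate of \<open>u\<close> near infinity,
  \<open>U (poly v z)\<close> and \<open>X z ^ degree v\<close> are both roots of order
  \<open>degree u\<close> of \<open>F\<close>. Their quotient \<open>\<rho>\<close> takes finitely
  many values and is continuous on the connected outside of a disc, so it is constant; as
  \<open>U\<close> is injective, the fibres of \<open>v\<close> are those of this power of
  \<open>X\<close>.\<close>

lemma fibres_at_infinity:
  fixes u v :: "complex poly"
  assumes "degree u > 0" "degree v > 0" "R > 0"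
    and X: "\<And>z. norm z > R \<Longrightarrow> X z ^ degree (pcompose u v) = poly (pcompose u v) z"
    and cont: "continuous_on {z. norm z > R} X"
  obtains R' where "R' \<ge> R"
    "\<And>x y. norm x > R' \<Longrightarrow> norm y > R' \<Longrightarrow> poly v x = poly v y \<longleftrightarrow> X x ^ degree v = X y ^ degree v"
proof -
  let ?m = "degree u" and ?s = "degree v" and ?F = "pcompose u v"
  obtain Ru U where Ru: "Ru > 0" "\<And>z. norm z > Ru \<Longrightarrow> U z ^ ?m = poly u z"
      "inj_on U {z. norm z > Ru}" "continuous_on {z. norm z > Ru} U"
    using uniformizer_at_infinity[OF assms(1)] by metis
  obtain R1 where R1: "\<And>z. norm z > R1 \<Longrightarrow> norm (poly v z) > Ru"
    using poly_large_at_infinity[OF assms(2)] by metis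
  have "degree ?F > 0"
    using assms(1,2) by (simp add: degree_pcompose)
  then obtain R2 where R2: "\<And>z. norm z > R2 \<Longrightarrow> norm (poly ?F z) > 0"
    using poly_large_at_infinity by metis
  define R' where "R' = max R (max R1 R2)"
  define S where "S = {z::complex. norm z > R'}"
  have big: "norm z > R" "norm (poly v z) > Ru" "poly ?F z \<noteq> 0" if "z \<in> S" for z
    using that R1[of z] R2[of z] by (auto simp: S_def R'_def)
  have X0: "X z \<noteq> 0" if "z \<in> S" for z
    using X[OF big(1)[OF that]] big(3)[OF that] \<open>degree ?F > 0\<close> by (metis zero_power)
  define \<rho> where "\<rho> z = U (poly v z) / X z ^ ?s" for z
  have "\<rho> z ^ ?m = 1" if "z \<in> S" for z
  proof -
    have "\<rho> z ^ ?m = U (poly v z) ^ ?m / X z ^ degree ?F"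
      by (simp add: \<rho>_def power_divide power_mult[symmetric] degree_pcompose mult.commute)
    also have "\<dots> = 1"
      using big[OF that] by (simp add: Ru(2) X poly_pcompose)
    finally show ?thesis .
  qed
  then have "finite (\<rho> ` S)"
    using finite_roots_unity[of ?m] assms(1) by (intro finite_subset[of "\<rho> ` S" "{z. z ^ ?m = 1}"]) auto
  moreover have "continuous_on S \<rho>"
    unfolding \<rho>_def
  proof (intro continuous_intros)
    show "continuous_on S (\<lambda>z. U (poly v z))"
      using Ru(4) by (rule continuous_on_compose2) (use big in \<open>auto intro!: continuous_intros\<close>)
    show "continuous_on S X"
      using cont by (rule continuous_on_subset) (use big in auto)
    show "\<forall>z\<in>S. X z ^ ?s \<noteq> 0"
      using X0 by simp
  qed
  moreover have "connected S"
  proof -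
    have "S = - cball 0 R'"
      by (auto simp: S_def)
    then show ?thesis
      using connected_complement_bounded_convex[of "cball (0::complex) R'"] by simp
  qed
  ultimately have "\<rho> constant_on S"
    by (intro continuous_finite_range_constant)
  then obtain c where c: "\<And>z. z \<in> S \<Longrightarrow> \<rho> z = c"
    unfolding constant_on_def by blast
  have Uv: "U (poly v z) = c * X z ^ ?s" if "z \<in> S" for z
    using c[OF that] X0[OF that] by (auto simp: \<rho>_def field_simps)
  show ?thesis
  proof
    show "R' \<ge> R"
      by (simp add: R'_def)
    fix x y :: complex assume "norm x > R'" "norm y > R'"
    then have S: "x \<in> S" "y \<in> S"
      by (auto simp: S_def)
    have c0: "c \<noteq> 0"
    proof
      assume "c = 0"
      then have "poly u (poly v x) = 0"
        using Uv[OF S(1)] Ru(2)[OF big(2)[OF S(1)]] assms(1) by (simp add: zero_power)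
      then show False
        using big(3)[OF S(1)] by (simp add: poly_pcompose)
    qed
    have "poly v x = poly v y \<longleftrightarrow> U (poly v x) = U (poly v y)"
      using Ru(3) big(2) S by (auto dest: inj_onD)
    then show "poly v x = poly v y \<longleftrightarrow> X x ^ ?s = X y ^ ?s"
      using Uv S c0 by simp
  qed
qed

text \<open>Over a large \<open>p\<close> the coordinate \<open>X\<close> turns the fibre into the
  set of all roots of order \<open>degree F\<close> of \<open>p\<close>, and two points agree under
  \<open>v\<close> or \<open>g\<close> when their quotient in \<open>X\<close> is a root of unity of
  order dividing \<open>degree v\<close> or \<open>degree g\<close>. The relations commute because
  multiplication does.\<close>

lemma fibre_relations_commute_at_infinity:
  fixes f g u v :: "complex poly"
  assumes "degree f > 0" "degree g > 0" "degree u > 0" "degree v > 0"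
    and F: "F = pcompose f g" "F = pcompose u v"
  obtains p where "p \<notin> critical_values F"
    "\<And>z1 z2 z3. poly F z1 = p \<Longrightarrow> poly F z2 = p \<Longrightarrow> poly F z3 = p \<Longrightarrow>
       poly v z1 = poly v z3 \<Longrightarrow> poly g z3 = poly g z2 \<Longrightarrow>
       \<exists>z4. poly F z4 = p \<and> poly g z1 = poly g z4 \<and> poly v z4 = poly v z2"
proof -
  let ?N = "degree F"
  have deg: "?N > 0"
    unfolding F(1) using assms(1,2) by (simp add: degree_pcompose)
  obtain R X where R: "R > 0" and X: "\<And>z. norm z > R \<Longrightarrow> X z ^ ?N = poly F z"
    and inj: "inj_on X {z. norm z > R}" and cont: "continuous_on {z. norm z > R} X"
    using uniformizer_at_infinity[OF deg] by metis
  obtain R1 where R1: "R1 \<ge> R" "\<And>x y. norm x > R1 \<Longrightarrow> norm y > R1 \<Longrightarrow>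
      poly v x = poly v y \<longleftrightarrow> X x ^ degree v = X y ^ degree v"
    using fibres_at_infinity[OF assms(3,4) R X[unfolded F(2)] cont] by blast
  obtain R2 where R2: "R2 \<ge> R" "\<And>x y. norm x > R2 \<Longrightarrow> norm y > R2 \<Longrightarrow>
      poly g x = poly g y \<longleftrightarrow> X x ^ degree g = X y ^ degree g"
    using fibres_at_infinity[OF assms(1,2) R X[unfolded F(1)] cont] by blast
  define R' where "R' = max R1 R2"
  \<comment> \<open>Taking \<open>p\<close> outside the image of a large disc makes its whole fibre
    large; \<open>p \<noteq> 0\<close> allows division by \<open>X z3\<close>.\<close>
  have "compact (poly F ` cball 0 R')"
    by (intro compact_continuous_image continuous_intros) auto
  then have "bounded (poly F ` cball 0 R' \<union> critical_values F \<union> {0})"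
    using finite_critical_values[OF deg] by (simp add: compact_imp_bounded finite_imp_bounded)
  then obtain p where p: "p \<notin> poly F ` cball 0 R'" "p \<notin> critical_values F" "p \<noteq> 0"
    using not_bounded_UNIV[where 'a = complex] by (metis UNIV_eq_I UnCI insertCI)
  have big: "norm z > R'" if "poly F z = p" for z
    using p(1) that by (meson image_eqI mem_cball_0 not_le)
  have bigR: "norm z > R" if "poly F z = p" for z
    using big[OF that] R1(1) by (simp add: R'_def)
  have roots: "X ` {z. poly F z = p} = {\<zeta>. \<zeta> ^ ?N = p}"
  proof (rule card_seteq)
    have eq: "{\<zeta>. \<zeta> ^ ?N = p} = {\<zeta>. poly (monom 1 ?N) \<zeta> = p}"
      by (simp add: poly_monom)
    have dm: "degree (monom (1::complex) ?N) = ?N"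
      by (simp add: degree_monom_eq)
    show "finite {\<zeta>. \<zeta> ^ ?N = p}"
      unfolding eq using deg by (intro finite_fibre) (simp add: dm)
    show "X ` {z. poly F z = p} \<subseteq> {\<zeta>. \<zeta> ^ ?N = p}"
      using X bigR by auto
    have "inj_on X {z. poly F z = p}"
      using inj by (rule inj_on_subset) (use bigR in auto)
    then have "card (X ` {z. poly F z = p}) = ?N"
      using card_fibre_regular[OF deg p(2)] by (simp add: card_image)
    moreover have "card {\<zeta>. \<zeta> ^ ?N = p} \<le> ?N"
      unfolding eq using card_fibre_le[of "monom (1::complex) ?N" p] deg by (simp add: dm)
    ultimately show "card {\<zeta>. \<zeta> ^ ?N = p} \<le> card (X ` {z. poly F z = p})"
      by simp
  qed
  show ?thesis
  proof
    show "p \<notin> critical_values F" by fact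
    fix z1 z2 z3
    assume z: "poly F z1 = p" "poly F z2 = p" "poly F z3 = p"
      and vg: "poly v z1 = poly v z3" "poly g z3 = poly g z2"
    have X3: "X z3 \<noteq> 0"
      using X[OF bigR[OF z(3)]] z(3) p(3) deg by (auto simp: zero_power)
    have v_iff: "poly v x = poly v y \<longleftrightarrow> X x ^ degree v = X y ^ degree v"
      and g_iff: "poly g x = poly g y \<longleftrightarrow> X x ^ degree g = X y ^ degree g"
      if "poly F x = p" "poly F y = p" for x y
      using R1(2) R2(2) big[OF that(1)] big[OF that(2)] by (auto simp: R'_def)
    \<comment> \<open>The fourth corner of a parallelogram in the multiplicative coordinate: it
      differs from \<open>z1\<close> as \<open>z2\<close> does from \<open>z3\<close>, and from
      \<open>z2\<close> as \<open>z1\<close> does from \<open>z3\<close>.\<close>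
    have "(X z1 * X z2 / X z3) ^ ?N = p"
      using X[OF bigR[OF z(1)]] X[OF bigR[OF z(2)]] X[OF bigR[OF z(3)]] z p(3)
      by (simp add: power_mult_distrib power_divide)
    then have "X z1 * X z2 / X z3 \<in> X ` {z. poly F z = p}"
      unfolding roots by simp
    then obtain z4 where z4: "poly F z4 = p" "X z4 = X z1 * X z2 / X z3"
      by auto
    have "X z1 ^ degree v = X z3 ^ degree v" "X z2 ^ degree g = X z3 ^ degree g"
      using vg v_iff[OF z(1,3)] g_iff[OF z(3,2)] by simp_all
    then have "X z4 ^ degree v = X z2 ^ degree v" "X z4 ^ degree g = X z1 ^ degree g"
      using X3 by (simp_all add: z4(2) power_mult_distrib power_divide)
    then have "poly g z1 = poly g z4" "poly v z4 = poly v z2"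
      using v_iff[OF z4(1) z(2)] g_iff[OF z(1) z4(1)] by simp_all
    then show "\<exists>z4. poly F z4 = p \<and> poly g z1 = poly g z4 \<and> poly v z4 = poly v z2"
      using z4(1) by blast
  qed
qed

text \<open>Transport preserves equality under \<open>v\<close> and under \<open>g\<close> in both
  directions, so the commutation found over one value \<open>q\<close> passes to every regular
  value.\<close>

lemma fibre_relations_commute:
  fixes f g u v :: "complex poly"
  assumes degs: "degree f > 0" "degree g > 0" "degree u > 0" "degree v > 0"
    and F: "F = pcompose f g" "F = pcompose u v" and p: "p \<notin> critical_values F"
    and z: "poly F z1 = p" "poly F z2 = p" "poly F z3 = p"
      "poly v z1 = poly v z3" "poly g z3 = poly g z2"
  obtains z4 where "poly F z4 = p" "poly g z1 = poly g z4" "poly v z4 = poly v z2"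
proof -
  have deg: "degree F > 0"
    unfolding F(1) using degs by (simp add: degree_pcompose)
  obtain q where q: "q \<notin> critical_values F"
    and comm: "\<And>z1 z2 z3. poly F z1 = q \<Longrightarrow> poly F z2 = q \<Longrightarrow> poly F z3 = q \<Longrightarrow>
       poly v z1 = poly v z3 \<Longrightarrow> poly g z3 = poly g z2 \<Longrightarrow>
       \<exists>z4. poly F z4 = q \<and> poly g z1 = poly g z4 \<and> poly v z4 = poly v z2"
    using fibre_relations_commute_at_infinity[OF degs F] by blast
  obtain \<gamma> where \<gamma>: "regular_path F \<gamma> p q"
    using regular_path_exists[OF deg p q] .
  obtain \<phi> where \<phi>: "bij_betw \<phi> {x. poly F x = p} {x. poly F x = q}"
      "\<And>x. poly F x = p \<Longrightarrow> transports F \<gamma> x (\<phi> x)"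
    using transport_map[OF deg \<gamma>] by blast
  have im: "poly F (\<phi> x) = q" if "poly F x = p" for x
    using transports_fibre(2)[OF \<gamma> \<phi>(2)[OF that]] .
  have v_iff: "poly v x = poly v y \<longleftrightarrow> poly v (\<phi> x) = poly v (\<phi> y)"
    if "poly F x = p" "poly F y = p" for x y
    using transports_pcompose_eq_iff[OF degs(3,4)] \<gamma> \<phi>(2)[OF that(1)] \<phi>(2)[OF that(2)]
    unfolding F(2) by blast
  have g_iff: "poly g x = poly g y \<longleftrightarrow> poly g (\<phi> x) = poly g (\<phi> y)"
    if "poly F x = p" "poly F y = p" for x y
    using transports_pcompose_eq_iff[OF degs(1,2)] \<gamma> \<phi>(2)[OF that(1)] \<phi>(2)[OF that(2)]
    unfolding F(1) by blast
  obtain y where y: "poly F y = q" "poly g (\<phi> z1) = poly g y" "poly v y = poly v (\<phi> z2)"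
    using comm[OF im[OF z(1)] im[OF z(2)] im[OF z(3)]] v_iff g_iff z by blast
  have "y \<in> \<phi> ` {x. poly F x = p}"
    using bij_betw_imp_surj_on[OF \<phi>(1)] y(1) by simp
  then obtain z4 where "poly F z4 = p" "y = \<phi> z4"
    by blast
  then show ?thesis
    using that y v_iff g_iff z by blast
qed

subsection \<open>Conservative polynomials\<close>

text \<open>With \<open>c\<close> as its only root, \<open>q - [:e:]\<close> is a constant multiple
  of a power of \<open>[:-c, 1:]\<close>, with exponent at least 2.\<close>

lemma pderiv_zero_iff_single_root:
  fixes q :: "complex poly"
  assumes "degree q \<ge> 2" and root: "{z. poly q z = e} = {c}"
  shows "poly (pderiv q) z = 0 \<longleftrightarrow> z = c"
proof -
  define P where "P = q - [:e:]"
  define r where "r = order c P"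
  have degP: "degree P = degree q"
    unfolding P_def using assms(1) by (intro degree_diff_const) simp
  have roots: "{z. poly P z = 0} = {c}"
    using root by (auto simp: P_def)
  have P: "P = smult (lead_coeff P) ([:-c, 1:] ^ r)"
    using complex_poly_decompose[of P] roots by (simp add: r_def)
  have L: "lead_coeff P \<noteq> 0"
    using assms(1) degP by (metis degree_0 leading_coeff_0_iff not_numeral_le_zero)
  have "degree P = degree ([:-c, 1:] ^ r)"
    using L by (subst P) (simp only: degree_smult_eq if_False)
  then have r: "r \<ge> 2"
    using assms(1) degP by (simp add: degree_power_eq)
  have "pderiv q = pderiv P"
    by (simp add: P_def pderiv_diff)
  also have "\<dots> = smult (lead_coeff P) (pderiv ([:-c, 1:] ^ r))"
    by (subst P) (simp only: pderiv_smult)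
  also have "\<dots> = smult (lead_coeff P) (smult (of_nat r) ([:-c, 1:] ^ (r - 1)))"
    by (simp add: pderiv_power pderiv_pCons)
  finally have "poly (pderiv q) z = lead_coeff P * (of_nat r * (z - c) ^ (r - 1))"
    by simp
  then show ?thesis
    using L r by simp
qed

text \<open>If \<open>e\<close> is a critical point of \<open>w\<close>, the points over
  \<open>e\<close> under \<open>q\<close> are critical for \<open>f\<close>, hence fixed, with
  common value \<open>poly w e\<close>. So this fibre is the single point \<open>poly w e\<close>,
  which is then the only critical point of \<open>q\<close>; in the end it is the only one of
  \<open>f\<close>.\<close>

lemma conservative_indecomposable:
  assumes "conservative f" and "\<exists>c1\<in>critical_points f. \<exists>c2\<in>critical_points f. c1 \<noteq> c2"
    and f: "f = pcompose w q"
  shows "degree w \<le> 1 \<or> degree q \<le> 1"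
proof (rule ccontr)
  assume "\<not> ?thesis"
  then have w: "degree w \<ge> 2" and q: "degree q \<ge> 2"
    by auto
  have crit: "z \<in> critical_points f \<longleftrightarrow> poly (pderiv w) (poly q z) = 0 \<or> poly (pderiv q) z = 0" for z
    by (simp add: critical_points_def f pderiv_pcompose poly_pcompose)
  have single: "{z. poly q z = e} = {poly w e}" if e: "poly (pderiv w) e = 0" for e
  proof -
    have eq: "z = poly w e" if "poly q z = e" for z
    proof -
      have "z \<in> critical_points f"
        unfolding crit that using e by simp
      then have "poly f z = z"
        using assms(1) by (simp add: conservative_def)
      moreover have "poly f z = poly w e"
        unfolding f poly_pcompose that ..
      ultimately show ?thesis
        by simp
    qed
    have "degree q > 0"
      using q by simp
    then obtain z where "poly q z = e"
      by (rule poly_surj_complex)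
    with eq[OF this] have "poly w e \<in> {z. poly q z = e}"
      by simp
    moreover have "{z. poly q z = e} \<subseteq> {poly w e}"
      using eq by blast
    ultimately show ?thesis
      by blast
  qed
  have "degree (pderiv w) > 0"
    using w by (simp add: degree_pderiv)
  then obtain e where e: "poly (pderiv w) e = 0"
    using alg_closed_imp_poly_has_root by blast
  have q': "poly (pderiv q) z = 0 \<longleftrightarrow> z = poly w e" for z
    by (rule pderiv_zero_iff_single_root[OF q single[OF e]])
  \<comment> \<open>A critical point of \<open>f\<close> coming from \<open>w\<close> is also one of
    \<open>q\<close>, by the fibre argument at \<open>poly q z\<close>.\<close>
  have all_eq: "z = poly w e" if "z \<in> critical_points f" for z
  proof -
    have "poly (pderiv q) z = 0"
    proof (cases "poly (pderiv w) (poly q z) = 0")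
      case True
      then have "z = poly w (poly q z)"
        using single[OF True] by blast
      then show ?thesis
        using pderiv_zero_iff_single_root[OF q single[OF True], of z] by simp
    qed (use that crit in simp)
    then show ?thesis
      using q' by simp
  qed
  obtain c1 c2 where "c1 \<in> critical_points f" "c2 \<in> critical_points f" "c1 \<noteq> c2"
    using assms(2) by blast
  then show False
    using all_eq[of c1] all_eq[of c2] by simp
qed

text \<open>Otherwise \<open>c\<close> would be the only preimage of \<open>c\<close>, and then the
  only critical point.\<close>

lemma critical_value_other_preimage:
  assumes "\<exists>c1\<in>critical_points f. \<exists>c2\<in>critical_points f. c1 \<noteq> c2" and "degree f \<ge> 2"
  obtains x where "poly f x = c" "x \<noteq> c"
proof (cases "\<exists>x. poly f x = c \<and> x \<noteq> c")
  case False
  moreover have "degree f > 0"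
    using assms(2) by simp
  then obtain x where "poly f x = c"
    by (rule poly_surj_complex)
  ultimately have "{z. poly f z = c} = {c}"
    by auto
  then have eq: "z = c" if "z \<in> critical_points f" for z
    using pderiv_zero_iff_single_root[OF assms(2)] that by (simp add: critical_points_def)
  obtain c1 c2 where "c1 \<in> critical_points f" "c2 \<in> critical_points f" "c1 \<noteq> c2"
    using assms(1) by blast
  then show ?thesis
    using eq[of c1] eq[of c2] by simp
qed (use that in blast)

section \<open>Critical points of iterates\<close>

lemma poly_iterate_Suc: "poly_iterate f (Suc n) = pcompose f (poly_iterate f n)"
  by (simp add: poly_iterate_def)

lemma degree_poly_iterate: "degree (poly_iterate f n) = degree f ^ n" for f :: "complex poly"
  by (induction n) (simp_all add: poly_iterate_Suc degree_pcompose, simp add: poly_iterate_def)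

text \<open>By the chain rule the orbit of \<open>z\<close> meets a critical point of
  \<open>f\<close> at one of the times 0 to \<open>n\<close>; that point is fixed, so the orbit
  stays there.\<close>

lemma critical_points_iterate:
  assumes "conservative f" "z \<in> critical_points (poly_iterate f (Suc n))"
  shows "poly (poly_iterate f n) z \<in> critical_points f"
  using assms(2)
proof (induction n)
  case 0
  then show ?case
    by (simp add: poly_iterate_def)
next
  case (Suc n)
  then have "poly (pderiv (pcompose f (poly_iterate f (Suc n)))) z = 0"
    by (simp only: critical_points_def mem_Collect_eq poly_iterate_Suc[of f "Suc n"])
  then have "poly (pderiv f) (poly (poly_iterate f (Suc n)) z) = 0 \<or>
      poly (pderiv (poly_iterate f (Suc n))) z = 0"
    by (simp only: pderiv_pcompose poly_mult poly_pcompose mult_eq_0_iff)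
  then consider "poly (poly_iterate f (Suc n)) z \<in> critical_points f"
    | "z \<in> critical_points (poly_iterate f (Suc n))"
    unfolding critical_points_def by blast
  then show ?case
  proof cases
    case 2
    then have "poly (poly_iterate f n) z \<in> critical_points f"
      by (rule Suc.IH)
    moreover from this have "poly (poly_iterate f (Suc n)) z = poly (poly_iterate f n) z"
      using assms(1) by (simp add: conservative_def poly_iterate_Suc poly_pcompose)
    ultimately show ?thesis
      by simp
  qed
qed

text \<open>This lets a loop that avoids the critical values of \<open>f\<close> be lifted through
  the iterate as well.\<close>

lemma critical_values_iterate_subset:
  assumes "conservative f"
  shows "critical_values (poly_iterate f (Suc n)) \<subseteq> critical_values f"
  using critical_points_iterate[OF assms]
  by (auto simp: critical_values_def poly_iterate_Suc poly_pcompose)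

lemma regular_path_mono:
  "critical_values F' \<subseteq> critical_values F \<Longrightarrow> regular_path F \<gamma> p q \<Longrightarrow> regular_path F' \<gamma> p q"
  by (auto simp: regular_path_def)

text \<open>
  The composite of the relations "equal under \<open>v\<close>" and "equal under \<open>g\<close>" descends to the fibre of
  \<open>f\<close>, where it is invariant under monodromy.  Indecomposability of \<open>f\<close> leaves only the coarsest
  relation.
\<close>

lemma conservative_fibre_relations_complete:
  fixes f g u v :: "complex poly"
  assumes cons: "conservative f"
    and two: "\<exists>c1\<in>critical_points f. \<exists>c2\<in>critical_points f. c1 \<noteq> c2"
    and degs: "degree f > 0" "degree g > 0" "degree u > 0" "degree v > 0"
    and F: "F = pcompose f g" "F = pcompose u v"
    and cv: "critical_values F \<subseteq> critical_values f"
    and p: "p \<notin> critical_values F"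
    and ab: "poly F a = p" "poly F b = p" "poly v a = poly v b" "poly g a \<noteq> poly g b"
    and z: "poly F z = p" "poly F y = p"
  obtains x where "poly F x = p" "poly v x = poly v z" "poly g x = poly g y"
proof -
  have degF: "degree F > 0"
    unfolding F(1) using degs by (simp add: degree_pcompose)
  have Fg: "poly F x = poly f (poly g x)" for x
    by (simp add: F(1) poly_pcompose)
  define rel where "rel s t \<longleftrightarrow>
    (\<exists>x y. poly F x = p \<and> poly F y = p \<and> poly v x = poly v y \<and> poly g x = s \<and> poly g y = t)" for s t
  have sym: "rel t s" if "rel s t" for s t
    using that unfolding rel_def by metis
  have comm: "\<exists>z4. poly F z4 = p \<and> poly g z1 = poly g z4 \<and> poly v z4 = poly v z2"
    if "poly F z1 = p" "poly F z2 = p" "poly F z3 = p" "poly v z1 = poly v z3" "poly g z3 = poly g z2"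
    for z1 z2 z3
    using fibre_relations_commute[OF degs F p that] by blast
  \<comment> \<open>Commutation moves the witness for \<open>rel\<close> into the fibre of
    \<open>v\<close> through a prescribed \<open>x\<close>.\<close>
  have relD: "\<exists>y. poly F y = p \<and> poly v y = poly v x \<and> poly g y = t"
    if x: "poly F x = p" and r: "rel (poly g x) t" for x t
  proof -
    obtain x' y where *: "poly F x' = p" "poly F y = p" "poly v x' = poly v y"
        "poly g x' = poly g x" "poly g y = t"
      using r unfolding rel_def by blast
    obtain z4 where "poly F z4 = p" "poly g y = poly g z4" "poly v z4 = poly v x"
      using comm[OF *(2) x *(1) *(3)[symmetric] *(4)] by blast
    then show ?thesis
      using *(5) by metis
  qed
  have trans: "rel r t" if rs: "rel r s" and st: "rel s t" for r s t
  proof -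
    obtain x y where *: "poly F x = p" "poly F y = p" "poly v x = poly v y" "poly g x = r" "poly g y = s"
      using rs unfolding rel_def by blast
    obtain w where "poly F w = p" "poly v w = poly v y" "poly g w = t"
      using relD[OF *(2)] st *(5) by blast
    then show ?thesis
      unfolding rel_def using * by metis
  qed
  have inv: "rel s' t'" if \<gamma>: "regular_path f \<gamma> p p" and st: "rel s t"
      and tr: "transports f \<gamma> s s'" "transports f \<gamma> t t'" for \<gamma> s t s' t'
  proof -
    have \<gamma>F: "regular_path F \<gamma> p p"
      using regular_path_mono[OF cv \<gamma>] .
    obtain x y where *: "poly F x = p" "poly F y = p" "poly v x = poly v y" "poly g x = s" "poly g y = t"
      using st unfolding rel_def by blast
    obtain x' y' where xy: "transports F \<gamma> x x'" "transports F \<gamma> y y'"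
      using transports_exists[OF degF \<gamma>F *(1)] transports_exists[OF degF \<gamma>F *(2)] by metis
    have "poly v x' = poly v y'"
      using transports_pcompose_eq_iff[OF degs(3,4), of \<gamma> p p x x' y y'] \<gamma>F xy *(3)
      unfolding F(2) by blast
    moreover have "transports f \<gamma> s (poly g x')" "transports f \<gamma> t (poly g y')"
      using transports_pcompose[of f g \<gamma>] xy *(4,5) unfolding F(1) by blast+
    then have "poly g x' = s'" "poly g y' = t'"
      using transports_unique[OF degs(1) \<gamma>] tr by blast+
    ultimately show ?thesis
      unfolding rel_def using transports_fibre(2)[OF \<gamma>F] xy by blast
  qed
  \<comment> \<open>The class of \<open>poly g a\<close> under \<open>rel\<close> will be a block
    for the monodromy group of \<open>f\<close>; it contains \<open>poly g b\<close> as a second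
    point.\<close>
  define C where "C = {t. rel (poly g a) t}"
  have ga: "poly g a \<in> C"
    unfolding C_def rel_def using ab(1) by blast
  have gb: "poly g b \<in> C"
    unfolding C_def rel_def using ab by blast
  have C_fibre: "C \<subseteq> {x. poly f x = p}"
    by (auto simp: C_def rel_def Fg)
  then have finC: "finite C"
    using finite_fibre[OF degs(1)] finite_subset by blast
  have "is_block (monodromy_group f p) {x. poly f x = p} C"
    unfolding is_block_def
  proof (intro conjI C_fibre ballI)
    fix \<sigma> assume "\<sigma> \<in> monodromy_group f p"
    then obtain \<gamma> where \<sigma>: "\<sigma> permutes {x. poly f x = p}" and \<gamma>: "regular_path f \<gamma> p p"
        and tr: "\<And>x. poly f x = p \<Longrightarrow> transports f \<gamma> x (\<sigma> x)"
      by (auto simp: monodromy_group_def loops_at_def regular_path_def transports_def)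
    have "\<sigma> ` C = C" if "\<sigma> ` C \<inter> C \<noteq> {}"
    proof -
      obtain s where s: "s \<in> C" "\<sigma> s \<in> C"
        using \<open>\<sigma> ` C \<inter> C \<noteq> {}\<close> by blast
      have "\<sigma> t \<in> C" if t: "t \<in> C" for t
      proof -
        have "rel s t"
          using s(1) t sym trans unfolding C_def by blast
        then have "rel (\<sigma> s) (\<sigma> t)"
          using inv[OF \<gamma>] tr s(1) t C_fibre by blast
        then show ?thesis
          using s(2) trans unfolding C_def by blast
      qed
      then have "\<sigma> ` C \<subseteq> C"
        by blast
      then show ?thesis
        using card_subset_eq[OF finC] card_image[of \<sigma> C] inj_on_subset[OF permutes_inj[OF \<sigma>]] by simp
    qed
    then show "\<sigma> ` C \<inter> C = C \<or> \<sigma> ` C \<inter> C = {}"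
      by blast
  qed
  moreover have "p \<notin> critical_values f"
    using p critical_values_pcompose[OF degs(2), of f] unfolding F(1) by blast
  ultimately obtain w where w: "f = pcompose w (\<Prod>c\<in>C. [:-c, 1:])"
    using block_decomposition[OF degs(1) _ _ ga] by blast
  \<comment> \<open>The inner factor has degree \<open>card C\<close>, at least 2, so
    indecomposability leaves \<open>w\<close> with degree at most 1 and makes \<open>C\<close> as
    large as the fibre.\<close>
  have "card {poly g a, poly g b} \<le> card C"
    using ga gb by (intro card_mono[OF finC]) auto
  then have "card C \<ge> 2"
    using ab(4) by simp
  then have "degree w \<le> 1"
    using conservative_indecomposable[OF cons two w] by (simp add: degree_prod_linear)
  moreover have deg_f: "degree f = degree w * card C"
    by (subst w) (simp add: degree_pcompose degree_prod_linear)
  ultimately have "card {x. poly f x = p} \<le> card C"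
    using card_fibre_le[OF degs(1), of p] degs(1) by (cases "degree w") auto
  then have C: "C = {x. poly f x = p}"
    using card_seteq[OF finite_fibre[OF degs(1)] C_fibre] by simp
  have "poly g z \<in> C" "poly g y \<in> C"
    using z unfolding C by (simp_all add: Fg)
  then have "rel (poly g z) (poly g y)"
    using sym trans unfolding C_def by blast
  then show ?thesis
    using relD[OF z(1)] that by blast
qed

text \<open>By the open mapping theorem \<open>z\<close> and \<open>y\<close> are limits of points
  \<open>Z k\<close> and \<open>Y k\<close> with a common regular value. The points
  \<open>X k\<close> supplied by \<open>complete\<close> stay bounded by
  \<open>fibre_linear_growth\<close>, so a subsequence converges, and continuity gives its limit
  both properties.\<close>

lemma fibre_relations_limit:
  fixes F v g :: "complex poly"
  assumes "degree F > 0"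
    and complete: "\<And>p z y. p \<notin> critical_values F \<Longrightarrow> poly F z = p \<Longrightarrow> poly F y = p \<Longrightarrow>
      \<exists>x. poly F x = p \<and> poly v x = poly v z \<and> poly g x = poly g y"
    and eq: "poly F z = poly F y"
  obtains x where "poly v x = poly v z" "poly g x = poly g y"
proof -
  let ?\<epsilon> = "\<lambda>k. inverse (real (Suc k))"
  have hol: "poly F holomorphic_on A" for A
    using poly_holomorphic_on[OF holomorphic_on_ident] by simp
  have nonconst: "\<not> poly F constant_on UNIV"
  proof
    assume "poly F constant_on UNIV"
    then obtain c where c: "\<And>x. poly F x = c"
      by (auto simp: constant_on_def)
    then have "{x. poly F x = c} = UNIV"
      by simp
    then show False
      using finite_fibre[OF assms(1), of c] infinite_UNIV_char_0[where 'a = complex] by simp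
  qed
  have open_im: "open (poly F ` ball x r)" for x r
    by (rule open_mapping_thm[OF hol open_UNIV connected_UNIV open_ball subset_UNIV nonconst])
  have "\<exists>z' y'. z' \<in> ball z (?\<epsilon> k) \<and> y' \<in> ball y (?\<epsilon> k) \<and> poly F z' = poly F y' \<and>
      poly F z' \<notin> critical_values F" for k
  proof -
    \<comment> \<open>Both images are open and contain \<open>poly F z\<close>, so they share
      infinitely many values, not all of them critical.\<close>
    let ?W = "poly F ` ball z (?\<epsilon> k) \<inter> poly F ` ball y (?\<epsilon> k)"
    have "open ?W"
      by (intro open_Int open_im)
    moreover have "poly F z \<in> poly F ` ball z (?\<epsilon> k)"
      by (rule imageI) simp
    moreover have "poly F z \<in> poly F ` ball y (?\<epsilon> k)"
      unfolding eq by (rule imageI) simp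
    ultimately have "open ?W" "?W \<noteq> {}"
      by blast+
    then have "infinite ?W"
      using finite_imp_not_open by blast
    then have "\<not> ?W \<subseteq> critical_values F"
      using finite_critical_values[OF assms(1)] finite_subset by blast
    then obtain w where "w \<in> ?W" "w \<notin> critical_values F"
      by blast
    then show ?thesis
      by (auto simp del: mem_ball)
  qed
  then obtain Z Y where ZY: "\<And>k. Z k \<in> ball z (?\<epsilon> k)" "\<And>k. Y k \<in> ball y (?\<epsilon> k)"
      "\<And>k. poly F (Z k) = poly F (Y k)" "\<And>k. poly F (Z k) \<notin> critical_values F"
    by metis
  have lim: "S \<longlonglongrightarrow> s" if "\<And>k. S k \<in> ball s (?\<epsilon> k)" for S and s :: complex
  proof (rule Lim_transform_bound[OF _ LIMSEQ_inverse_real_of_nat, THEN LIM_zero_cancel])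
    show "\<forall>\<^sub>F k in sequentially. norm (S k - s) \<le> norm (?\<epsilon> k)"
      using that by (intro always_eventually allI) (simp add: dist_norm norm_minus_commute less_imp_le)
  qed
  note limZ = lim[of Z, OF ZY(1)] and limY = lim[of Y, OF ZY(2)]
  obtain X where X: "\<And>k. poly F (X k) = poly F (Z k)" "\<And>k. poly v (X k) = poly v (Z k)"
      "\<And>k. poly g (X k) = poly g (Y k)"
    using complete[OF ZY(4) refl ZY(3)[symmetric]] by metis
  obtain C where C: "\<And>x y. poly F x = poly F y \<Longrightarrow> norm y \<le> C + 4 * norm x"
    using fibre_linear_growth[OF assms(1)] by metis
  obtain K where K: "\<And>k. norm (Z k) \<le> K"
    using convergent_imp_Bseq[OF convergentI[OF limZ]] by (auto simp: Bseq_def)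
  have "norm (X k) \<le> C + 4 * K" for k
    using C[OF X(1)[symmetric], of k] K[of k] by linarith
  then have "X k \<in> cball 0 (C + 4 * K)" for k
    by simp
  then obtain x r where x: "strict_mono r" "(X \<circ> r) \<longlonglongrightarrow> x"
    using compact_cball[of "0::complex" "C + 4 * K"] unfolding compact_def by metis
  have sub: "(\<lambda>k. poly q (S (r k))) \<longlonglongrightarrow> poly q s" if "S \<longlonglongrightarrow> s" for q S and s :: complex
    using LIMSEQ_subseq_LIMSEQ[OF that x(1)] by (intro tendsto_intros) (simp add: o_def)
  have limX: "(\<lambda>k. poly q (X (r k))) \<longlonglongrightarrow> poly q x" for q
    using x(2) by (intro tendsto_intros) (simp add: o_def)
  show ?thesis
  proof
    show "poly v x = poly v z"
      using LIMSEQ_unique[OF limX[of v]] sub[OF limZ, of v] by (simp add: X(2))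
    show "poly g x = poly g y"
      using LIMSEQ_unique[OF limX[of g]] sub[OF limY, of g] by (simp add: X(3))
  qed
qed

text \<open>Were \<open>f\<close> constant, every point would be critical and hence fixed; so the
  derivative is nonzero, and having the root \<open>c\<close> it is not constant.\<close>

lemma conservative_degree_ge_2:
  assumes "conservative f" and "c \<in> critical_points f"
  shows "degree f \<ge> 2"
proof -
  have "pderiv f \<noteq> 0"
  proof
    assume "pderiv f = 0"
    then have "poly f x = x" for x
      using assms(1) by (auto simp: conservative_def critical_points_def)
    then have "poly f 0 = 0" "poly f 1 = 1"
      by blast+
    moreover obtain h where "f = [:h:]"
      using \<open>pderiv f = 0\<close> by (auto simp: pderiv_eq_0_iff elim: degree_eq_zeroE)
    ultimately show False
      by simp
  qed
  moreover have "poly (pderiv f) c = 0"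
    using assms(2) by (simp add: critical_points_def)
  ultimately have "degree (pderiv f) \<noteq> 0"
    by (metis degree_eq_zeroE pCons_0_0 poly_const_conv)
  then show ?thesis
    by (simp add: degree_pderiv)
qed

section \<open>Blocks that meet two major branches\<close>

text \<open>Writing \<open>F = pcompose u v\<close> with \<open>B\<close> as a fibre of
  \<open>v\<close>, it is enough that \<open>u\<close> is linear: \<open>B\<close> then has
  \<open>degree F\<close> points, as many as the fibre of \<open>F\<close>.\<close>

lemma conservative_block_eq_fibre:
  assumes cons: "conservative f"
    and two: "\<exists>c1\<in>critical_points f. \<exists>c2\<in>critical_points f. c1 \<noteq> c2"
    and F: "F = poly_iterate f (Suc k)" and p: "p \<notin> critical_values F"
    and block: "is_block (monodromy_group F p) {x. poly F x = p} B"
    and ab: "a \<in> B" "b \<in> B" "poly (poly_iterate f k) a \<noteq> poly (poly_iterate f k) b"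
  shows "B = {x. poly F x = p}"
proof -
  define g where "g = poly_iterate f k"
  have Ffg: "F = pcompose f g"
    by (simp add: F g_def poly_iterate_Suc)
  have Fg: "poly F x = poly f (poly g x)" for x
    by (simp add: Ffg poly_pcompose)
  have deg_f: "degree f \<ge> 2"
    using conservative_degree_ge_2[OF cons] two by blast
  then have deg_f0: "degree f > 0" and deg_g: "degree g > 0"
    by (simp_all add: g_def degree_poly_iterate)
  have deg_F: "degree F > 0"
    unfolding Ffg using deg_f0 deg_g by (simp add: degree_pcompose)
  have B_fibre: "B \<subseteq> {x. poly F x = p}"
    using block by (simp add: is_block_def)
  have finB: "finite B"
    using B_fibre finite_fibre[OF deg_F] by (rule finite_subset)
  define v where "v = (\<Prod>b\<in>B. [:-b, 1:])"
  have deg_v: "degree v = card B"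
    by (simp add: v_def degree_prod_linear)
  have deg_v0: "degree v > 0"
    unfolding deg_v using finB ab(1) card_gt_0_iff by blast
  have v0: "poly v x = 0 \<longleftrightarrow> x \<in> B" for x
    using finB by (auto simp: v_def poly_prod)
  obtain u where Fuv: "F = pcompose u v"
    using block_decomposition[OF deg_F p block ab(1)] unfolding v_def by blast
  have deg_uv: "degree F = degree u * degree v"
    by (subst Fuv) (rule degree_pcompose)
  then have deg_u0: "degree u > 0"
    using deg_F by (cases "degree u") auto
  have cv: "critical_values F \<subseteq> critical_values f"
    unfolding F by (rule critical_values_iterate_subset[OF cons])
  have "poly v a = 0" "poly v b = 0"
    using v0 ab(1,2) by blast+
  then have a_b: "poly F a = p" "poly F b = p" "poly v a = poly v b" "poly g a \<noteq> poly g b"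
    using ab B_fibre by (auto simp: g_def)
  \<comment> \<open>\<open>conservative_fibre_relations_complete\<close> applies over
    \<open>p\<close>, where \<open>a\<close> and \<open>b\<close> are available; transport carries
    its conclusion to every regular value.\<close>
  have complete: "\<exists>x. poly F x = q \<and> poly v x = poly v z \<and> poly g x = poly g y"
    if q: "q \<notin> critical_values F" and zy: "poly F z = q" "poly F y = q" for q z y
  proof -
    obtain \<gamma> where \<gamma>: "regular_path F \<gamma> p q"
      using regular_path_exists[OF deg_F p q] .
    obtain \<phi> where \<phi>: "bij_betw \<phi> {x. poly F x = p} {x. poly F x = q}"
        "\<And>x. poly F x = p \<Longrightarrow> transports F \<gamma> x (\<phi> x)"
      using transport_map[OF deg_F \<gamma>] by blast
    have v_iff: "poly v x = poly v x' \<longleftrightarrow> poly v (\<phi> x) = poly v (\<phi> x')"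
      and g_iff: "poly g x = poly g x' \<longleftrightarrow> poly g (\<phi> x) = poly g (\<phi> x')"
      if "poly F x = p" "poly F x' = p" for x x'
      using transports_pcompose_eq_iff[OF deg_u0 deg_v0, of \<gamma> p q x "\<phi> x" x' "\<phi> x'", folded Fuv]
        transports_pcompose_eq_iff[OF deg_f0 deg_g, of \<gamma> p q x "\<phi> x" x' "\<phi> x'", folded Ffg]
        \<gamma> \<phi>(2) that by blast+
    have "z \<in> \<phi> ` {x. poly F x = p}" "y \<in> \<phi> ` {x. poly F x = p}"
      using bij_betw_imp_surj_on[OF \<phi>(1)] zy by simp_all
    then obtain z' y' where z'y': "poly F z' = p" "z = \<phi> z'" "poly F y' = p" "y = \<phi> y'"
      by blast
    obtain x where x: "poly F x = p" "poly v x = poly v z'" "poly g x = poly g y'"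
      using conservative_fibre_relations_complete[OF cons two deg_f0 deg_g deg_u0 deg_v0 Ffg Fuv cv p a_b
          z'y'(1,3)] .
    have "poly F (\<phi> x) = q"
      using transports_fibre(2)[OF \<gamma> \<phi>(2)[OF x(1)]] .
    then show ?thesis
      using v_iff[OF x(1) z'y'(1)] g_iff[OF x(1) z'y'(3)] x z'y' by blast
  qed
  have "degree u = 1"
  \<comment> \<open>A critical point \<open>e\<close> of \<open>u\<close> makes the whole fibre of
    \<open>v\<close> over \<open>e\<close> critical for \<open>F\<close>. One of its points is
    mapped by \<open>g\<close> to \<open>x0\<close>, which \<open>f\<close> sends to
    \<open>poly u e\<close>, a different point; yet \<open>critical_points_iterate\<close> makes
    \<open>x0\<close> a critical and hence fixed point of \<open>f\<close>.\<close>
  proof (rule ccontr)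
    assume "degree u \<noteq> 1"
    then have "degree (pderiv u) > 0"
      using deg_u0 by (simp add: degree_pderiv)
    then obtain e where e: "poly (pderiv u) e = 0"
      using alg_closed_imp_poly_has_root by blast
    obtain z where z: "poly v z = e"
      by (rule poly_surj_complex[OF deg_v0])
    obtain x0 where x0: "poly f x0 = poly u e" "x0 \<noteq> poly u e"
      by (rule critical_value_other_preimage[OF two deg_f])
    obtain y where y: "poly g y = x0"
      by (rule poly_surj_complex[OF deg_g])
    have "poly F z = poly u e"
      by (simp add: Fuv poly_pcompose z)
    then have "poly F z = poly F y"
      using x0(1) y by (simp add: Fg)
    then obtain x where x: "poly v x = poly v z" "poly g x = poly g y"
      using fibre_relations_limit[OF deg_F complete] by blast
    have "poly (pderiv F) x = 0"
      by (simp add: Fuv pderiv_pcompose poly_pcompose x(1) z e)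
    then have "poly g x \<in> critical_points f"
      using critical_points_iterate[OF cons, of x k] by (simp add: critical_points_def g_def F)
    then have "poly f x0 = x0"
      using cons x(2) y by (simp add: conservative_def)
    then show False
      using x0 by simp
  qed
  then have "card B = card {x. poly F x = p}"
    using deg_uv deg_v card_fibre_regular[OF deg_F p] by simp
  then show ?thesis
    by (rule card_subset_eq[OF finite_fibre[OF deg_F] B_fibre])
qed

theorem corollary4p4:
  fixes f :: "complex poly" and n :: nat and p :: complex and E :: "complex set"
  assumes "conservative f"
    and "\<exists>c1\<in>critical_points f. \<exists>c2\<in>critical_points f. c1 \<noteq> c2"
    and "n \<ge> 1"
    and "p \<notin> critical_values (poly_iterate f n)"
    and "E \<subseteq> tree_level f p n"
    and "\<exists>M1\<in>major_branches f p n. \<exists>M2\<in>major_branches f p n.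
           M1 \<noteq> M2 \<and> E \<inter> M1 \<noteq> {} \<and> E \<inter> M2 \<noteq> {}"
  shows "is_smallest_block_containing (level_monodromy_group f p n) (tree_level f p n)
           E (tree_level f p n)"
proof -
  obtain k where n: "n = Suc k"
    using assms(3) by (cases n) auto
  let ?F = "poly_iterate f (Suc k)"
  have level: "tree_level f p n = {x. poly ?F x = p}"
    by (simp only: tree_level_def poly_poly_iterate n)
  have group: "level_monodromy_group f p n = monodromy_group ?F p"
    by (simp add: level_monodromy_group_def n)
  \<comment> \<open>As \<open>n - 1 = k\<close>, major branches are told apart by their values under
    \<open>poly_iterate f k\<close>.\<close>
  obtain a b where ab: "a \<in> E" "b \<in> E" "poly (poly_iterate f k) a \<noteq> poly (poly_iterate f k) b"
  proof -
    obtain M1 M2 where M: "M1 \<in> major_branches f p n" "M2 \<in> major_branches f p n" "M1 \<noteq> M2"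
        "E \<inter> M1 \<noteq> {}" "E \<inter> M2 \<noteq> {}"
      using assms(6) by blast
    then obtain x1 x2
      where M1: "M1 = {y \<in> tree_level f p n. poly (poly_iterate f k) y = x1}"
        and M2: "M2 = {y \<in> tree_level f p n. poly (poly_iterate f k) y = x2}"
      unfolding major_branches_def poly_poly_iterate n by auto
    have "x1 \<noteq> x2"
      using M(3) M1 M2 by blast
    moreover obtain a b where "a \<in> E \<inter> M1" "b \<in> E \<inter> M2"
      using M(4,5) by blast
    ultimately show ?thesis
      using that[of a b] M1 M2 by simp
  qed
  have "tree_level f p n \<subseteq> B"
    if block: "is_block (level_monodromy_group f p n) (tree_level f p n) B" and EB: "E \<subseteq> B" for B
  proof -
    have "a \<in> B" "b \<in> B"
      using ab(1,2) EB by blast+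
    then have "B = {x. poly ?F x = p}"
      using conservative_block_eq_fibre[OF assms(1,2) refl _ _ _ _ ab(3)] assms(4)[unfolded n]
        block[unfolded level group] by blast
    then show ?thesis
      by (simp add: level)
  qed
  moreover have "is_block (level_monodromy_group f p n) (tree_level f p n) (tree_level f p n)"
    unfolding level group is_block_def by (simp add: monodromy_group_def permutes_image)
  ultimately show ?thesis
    using assms(5) unfolding is_smallest_block_containing_def by blast
qed

end
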